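(* Let $\Omega\subset\mathbb{R}^n$ be an open and bounded domain and let $1\le p<\infty$. Then every solution $u^*$ of $$u^*\in\operatorname*{arg\,min}_{u\in W^{1,\infty}_0(\Omega),\,u\neq 0}\frac{\mathcal{J}(u)}{\|u\|_p}$$ is a (scalar) multiple of the distance function $d(x)=\operatorname{dist}(x,\partial\Omega)=\inf_{y\in\partial\Omega}|x-y|$, $x\in\Omega$.
   Context: $W^{1,\infty}_0(\Omega)=\{u\in W^{1,\infty}(\Omega): u=0\text{ on }\partial\Omega\}$, i.e. the Lipschitz continuous functions vanishing on $\partial\Omega$. For $u\in W^{1,\infty}_0(\Omega)$, $\mathcal{J}(u)=\|\nabla u\|_\infty=\operatorname{ess\,sup}_\Omega|\nabla u|$ with $|\cdot|$ the Euclidean norm. $\|\cdot\|_p$ is the $L^p(\Omega)$-norm. *)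

theory Defs
  imports "HOL-Analysis.Analysis" "HOL-Probability.Essential_Supremum"
begin

text \<open>\<open>Ck k f\<close>: all iterated partial derivatives of \<open>f\<close> up to order \<open>k\<close> exist and are continuous.
  Requiring Frechet differentiability at each stage is no restriction for \<open>C\<^sup>k\<close> functions.\<close>

primrec Ck :: "nat \<Rightarrow> ('a::euclidean_space \<Rightarrow> real) \<Rightarrow> bool" where
  "Ck 0 f \<longleftrightarrow> continuous_on UNIV f"
| "Ck (Suc k) f \<longleftrightarrow> (\<forall>x. f differentiable (at x)) \<and>
     (\<forall>b\<in>Basis. Ck k (\<lambda>x. frechet_derivative f (at x) b))"

text \<open>\<open>C\<^sub>c\<^sup>\<infinity>(\<Omega>)\<close>, its elements being extended by zero to the whole space.\<close>

definition test_functions :: "'a::euclidean_space set \<Rightarrow> ('a \<Rightarrow> real) set" where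
  "test_functions \<Omega> = {\<phi>. (\<forall>k. Ck k \<phi>) \<and>
     compact (closure {x. \<phi> x \<noteq> 0}) \<and> closure {x. \<phi> x \<noteq> 0} \<subseteq> \<Omega>}"

definition locally_integrable ::
    "'a::euclidean_space set \<Rightarrow> ('a \<Rightarrow> 'b::euclidean_space) \<Rightarrow> bool" where
  "locally_integrable \<Omega> f \<longleftrightarrow> (\<forall>K. compact K \<and> K \<subseteq> \<Omega> \<longrightarrow> set_integrable lebesgue K f)"

definition has_weak_gradient ::
    "'a::euclidean_space set \<Rightarrow> ('a \<Rightarrow> real) \<Rightarrow> ('a \<Rightarrow> 'a) \<Rightarrow> bool" where
  "has_weak_gradient \<Omega> u g \<longleftrightarrow> locally_integrable \<Omega> u \<and> locally_integrable \<Omega> g \<and>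
     (\<forall>\<phi>\<in>test_functions \<Omega>. \<forall>b\<in>Basis.
        (LINT x|lebesgue_on \<Omega>. u x * frechet_derivative \<phi> (at x) b)
          = - (LINT x|lebesgue_on \<Omega>. (g x \<bullet> b) * \<phi> x))"

text \<open>Unique up to null sets when a weak gradient exists, so the choice is immaterial for
  essential suprema.\<close>

definition weak_gradient :: "'a::euclidean_space set \<Rightarrow> ('a \<Rightarrow> real) \<Rightarrow> 'a \<Rightarrow> 'a" where
  "weak_gradient \<Omega> u = (SOME g. has_weak_gradient \<Omega> u g)"

definition Linfty :: "'a::euclidean_space set \<Rightarrow> ('a \<Rightarrow> 'b::euclidean_space) set" where
  "Linfty \<Omega> = {f. f \<in> borel_measurable (lebesgue_on \<Omega>) \<and>
     (\<exists>C. AE x in lebesgue_on \<Omega>. norm (f x) \<le> C)}"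

definition W1_infty :: "'a::euclidean_space set \<Rightarrow> ('a \<Rightarrow> real) set" where
  "W1_infty \<Omega> = {u. u \<in> Linfty \<Omega> \<and> (\<exists>g. has_weak_gradient \<Omega> u g \<and> g \<in> Linfty \<Omega>)}"

text \<open>Elements are the continuous representatives on the closure of \<open>\<Omega>\<close>, so that the boundary
  condition is meant pointwise. Values outside the closure are irrelevant.\<close>

definition W1_infty_0 :: "'a::euclidean_space set \<Rightarrow> ('a \<Rightarrow> real) set" where
  "W1_infty_0 \<Omega> = {u. u \<in> W1_infty \<Omega> \<and> continuous_on (closure \<Omega>) u \<and>
     (\<forall>x\<in>frontier \<Omega>. u x = 0)}"

text \<open>The essential supremum is finite for \<open>u \<in> W1_infty \<Omega>\<close> and nonempty open \<open>\<Omega>\<close>; only then is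
  this value meaningful (\<open>real_of_ereal\<close> sends infinite values to 0).\<close>

definition J :: "'a::euclidean_space set \<Rightarrow> ('a \<Rightarrow> real) \<Rightarrow> real" where
  "J \<Omega> u = real_of_ereal (esssup (lebesgue_on \<Omega>) (\<lambda>x. ereal (norm (weak_gradient \<Omega> u x))))"

definition Lp_norm :: "real \<Rightarrow> 'a::euclidean_space set \<Rightarrow> ('a \<Rightarrow> real) \<Rightarrow> real" where
  "Lp_norm p \<Omega> u = (LINT x|lebesgue_on \<Omega>. \<bar>u x\<bar> powr p) powr (1 / p)"

end

theory Submission
  imports Defs "HOL-Computational_Algebra.Polynomial"
begin

text \<open>
  Write \<open>d x = dist x (frontier \<Omega>)\<close>. A weak gradient bounded by \<open>L\<close> makes a continuous function
  \<open>L\<close>-Lipschitz along segments in \<open>\<Omega>\<close>, so following the segment from \<open>x\<close> to a nearest boundary point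
  gives \<open>\<bar>u x\<bar> \<le> J u * d x\<close> and hence \<open>Lp_norm u \<le> J u * Lp_norm d\<close>. Since \<open>d\<close> is admissible with
  \<open>J d \<le> 1\<close>, minimality of \<open>u\<close> forces equality here, so \<open>\<bar>u\<bar> = J u * d\<close> on \<open>\<Omega>\<close> by continuity. As \<open>d > 0\<close>
  on the connected set \<open>\<Omega>\<close>, the sign of \<open>u\<close> is constant.

  The equivalence of Lipschitz and weak gradient bounds comes from differentiating the integral of
  \<open>u z * \<psi> (z - t w)\<close> in \<open>t\<close> for a test function \<open>\<psi>\<close>. That \<open>d\<close> has a weak gradient needs no Rademacher
  theorem: the function \<open>(norm x)\<^sup>2 - (d x)\<^sup>2\<close> is convex, so \<open>d\<close> has one-sided directional derivatives
  everywhere in \<open>\<Omega>\<close>, and dominated convergence applies to the difference quotients.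
\<close>

section \<open>Smooth functions and test functions\<close>

definition smooth :: "('a::euclidean_space \<Rightarrow> real) \<Rightarrow> bool" where
  "smooth f \<longleftrightarrow> (\<forall>k. Ck k f)"

text \<open>Derivatives at a point are unique, so any explicitly known derivative may replace
  \<open>frechet_derivative\<close>; most \<open>Ck\<close> proofs below go through this
  rule.\<close>

lemma Ck_SucI:
  assumes "\<And>x. (f has_derivative f' x) (at x)" "\<And>b. b \<in> Basis \<Longrightarrow> Ck k (\<lambda>x. f' x b)"
  shows "Ck (Suc k) f"
proof -
  have "frechet_derivative f (at x) = f' x" for x
    using frechet_derivative_at[OF assms(1)] by metis
  then show ?thesis using assms by (auto simp: differentiable_def)
qed

lemma Ck_Suc_has_derivative:
  "Ck (Suc k) f \<Longrightarrow> (f has_derivative frechet_derivative f (at x)) (at x)"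
  by (simp add: frechet_derivative_works)

lemma Ck_Suc_imp_Ck: "Ck (Suc k) f \<Longrightarrow> Ck k f"
proof (induction k arbitrary: f)
  case 0
  then show ?case
    by (simp add: continuous_at_imp_continuous_on differentiable_imp_continuous_within)
next
  case (Suc k)
  then show ?case by (metis Ck.simps(2))
qed

lemma smooth_has_derivative:
  "smooth f \<Longrightarrow> (f has_derivative frechet_derivative f (at x)) (at x)"
  unfolding smooth_def by (blast intro: Ck_Suc_has_derivative)

lemma smooth_partial: "smooth f \<Longrightarrow> b \<in> Basis \<Longrightarrow> smooth (\<lambda>x. frechet_derivative f (at x) b)"
  unfolding smooth_def by (metis Ck.simps(2))

lemma smooth_continuous: "smooth f \<Longrightarrow> continuous_on S f"
  by (metis Ck.simps(1) continuous_on_subset smooth_def subset_UNIV)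

section \<open>Closure properties of C^k and smooth functions\<close>

lemma Ck_const: "Ck k (\<lambda>x. c)"
proof (induction k arbitrary: c)
  case (Suc k)
  show ?case by (rule Ck_SucI[where f' = "\<lambda>x h. 0"]) (auto intro: Suc)
qed simp

lemma Ck_add: "Ck k f \<Longrightarrow> Ck k g \<Longrightarrow> Ck k (\<lambda>x. f x + g x)"
proof (induction k arbitrary: f g)
  case 0 then show ?case by (simp add: continuous_on_add)
next
  case (Suc k)
  show ?case
  proof (rule Ck_SucI)
    show "((\<lambda>x. f x + g x) has_derivative
            (\<lambda>h. frechet_derivative f (at x) h + frechet_derivative g (at x) h)) (at x)" for x
      by (intro has_derivative_add Ck_Suc_has_derivative[OF Suc.prems(1)] Ck_Suc_has_derivative[OF Suc.prems(2)])
  qed (use Suc in auto)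
qed

lemma Ck_mult: "Ck k f \<Longrightarrow> Ck k g \<Longrightarrow> Ck k (\<lambda>x. f x * g x)"
proof (induction k arbitrary: f g)
  case 0 then show ?case by (simp add: continuous_on_mult)
next
  case (Suc k)
  show ?case
  proof (rule Ck_SucI)
    show "((\<lambda>x. f x * g x) has_derivative
            (\<lambda>h. f x * frechet_derivative g (at x) h + frechet_derivative f (at x) h * g x)) (at x)" for x
      by (intro has_derivative_mult Ck_Suc_has_derivative[OF Suc.prems(1)] Ck_Suc_has_derivative[OF Suc.prems(2)])
    show "Ck k (\<lambda>x. f x * frechet_derivative g (at x) b + frechet_derivative f (at x) b * g x)"
      if "b \<in> Basis" for b
      using Suc.prems Suc.prems[THEN Ck_Suc_imp_Ck] that by (intro Ck_add Suc.IH) auto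
  qed
qed

text \<open>The chain rule turns the partial derivative into a derivative of \<open>F\<close> at
  \<open>q x\<close> times a partial of \<open>q\<close>. The former is again a smooth function
  composed with \<open>q\<close>, so the induction fixes \<open>q\<close> and varies
  \<open>F\<close>.\<close>

lemma Ck_compose:
  fixes F :: "real \<Rightarrow> real"
  assumes "smooth F" "smooth q"
  shows "Ck k (\<lambda>x. F (q x))"
  using assms(1)
proof (induction k arbitrary: F)
  case 0
  then show ?case
    using continuous_on_compose2[OF smooth_continuous[OF 0] smooth_continuous[OF assms(2)]]
    by auto
next
  case (Suc k)
  show ?case
  proof (rule Ck_SucI)
    show "((\<lambda>x. F (q x)) has_derivative
       (\<lambda>h. frechet_derivative F (at (q x)) (frechet_derivative q (at x) h))) (at x)" for x
      using has_derivative_compose[OF smooth_has_derivative[OF assms(2)]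
          smooth_has_derivative[OF Suc.prems]] .
    \<comment> \<open>Factoring out the direction leaves the derivative in direction 1, the only
      basis vector of the reals, to which \<open>smooth_partial\<close> applies.\<close>
    have *: "frechet_derivative F (at t) h = frechet_derivative F (at t) 1 * h" for t h
    proof -
      have "linear (frechet_derivative F (at t))"
        using has_derivative_linear[OF smooth_has_derivative[OF Suc.prems]] .
      from linear_scale[OF this, of h 1] show ?thesis by simp
    qed
    show "Ck k (\<lambda>x. frechet_derivative F (at (q x)) (frechet_derivative q (at x) b))"
      if "b \<in> Basis" for b
      using Suc.IH[OF smooth_partial[OF Suc.prems, of 1]] smooth_partial[OF assms(2) that]
      by (subst *) (auto intro!: Ck_mult simp: smooth_def)
  qed
qed

lemma Ck_translate: "Ck k f \<Longrightarrow> Ck k (\<lambda>x. f (x - a))"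
proof (induction k arbitrary: f)
  case 0
  then have "continuous_on UNIV f" by simp
  then show ?case
    by simp (rule continuous_on_compose2[where g = f and t = UNIV], auto intro!: continuous_intros)
next
  case (Suc k)
  show ?case
  proof (rule Ck_SucI)
    show "((\<lambda>x. f (x - a)) has_derivative frechet_derivative f (at (x - a))) (at x)" for x
    proof (rule has_derivative_compose[of "\<lambda>x. x - a" "\<lambda>h. h" x UNIV, simplified])
      show "((\<lambda>x. x - a) has_derivative (\<lambda>h. h)) (at x)"
        by (auto intro!: derivative_eq_intros)
    qed (rule Ck_Suc_has_derivative[OF Suc.prems])
  qed (use Suc in auto)
qed

lemma Ck_affine: "Ck k (\<lambda>x. x \<bullet> c + a)"
proof (cases k)
  case (Suc j)
  show ?thesis unfolding Suc
    by (rule Ck_SucI[where f' = "\<lambda>x h. h \<bullet> c"])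
      (auto intro!: derivative_eq_intros Ck_const)
qed (auto intro!: continuous_intros)

lemma Ck_norm_power2: "Ck k (\<lambda>x. (norm (x - c))\<^sup>2)"
proof (cases k)
  case (Suc j)
  have eq: "2 * (b \<bullet> (x - c)) = x \<bullet> (2 *\<^sub>R b) + (- 2 * (b \<bullet> c))" for b x :: 'a
    by (simp add: algebra_simps inner_commute)
  show ?thesis unfolding Suc power2_norm_eq_inner
    by (rule Ck_SucI[where f' = "\<lambda>x h. 2 * (h \<bullet> (x - c))"], (auto intro!: derivative_eq_intros simp: inner_commute)[1],
       subst eq, rule Ck_affine)
qed (auto intro!: continuous_intros)

lemma smooth_exp: "smooth (exp :: real \<Rightarrow> real)"
proof -
  have "Ck k (exp :: real \<Rightarrow> real)" for k
  proof (induction k)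
    case (Suc k)
    show ?case
      by (rule Ck_SucI[where f' = "\<lambda>x h. exp x * h"])
        (auto intro!: derivative_eq_intros Ck_mult Suc Ck_const)
  qed (auto intro!: continuous_intros)
  then show ?thesis by (simp add: smooth_def)
qed

lemma smooth_const: "smooth (\<lambda>x. c)"
  by (simp add: smooth_def Ck_const)

lemma smooth_add: "smooth f \<Longrightarrow> smooth g \<Longrightarrow> smooth (\<lambda>x. f x + g x)"
  by (simp add: smooth_def Ck_add)

lemma smooth_mult: "smooth f \<Longrightarrow> smooth g \<Longrightarrow> smooth (\<lambda>x. f x * g x)"
  by (simp add: smooth_def Ck_mult)

lemma smooth_sum:
  "(\<And>i. i \<in> I \<Longrightarrow> smooth (f i)) \<Longrightarrow> smooth (\<lambda>x. \<Sum>i\<in>I. f i x)"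
  by (induction I rule: infinite_finite_induct) (auto simp: smooth_const smooth_add)

lemma smooth_compose: "smooth F \<Longrightarrow> smooth q \<Longrightarrow> smooth (\<lambda>x. F (q x))" for F :: "real \<Rightarrow> real"
  using Ck_compose[of F q] by (simp add: smooth_def)

text \<open>This family contains \<open>exp (- 1 / t)\<close> (for \<open>P = 1\<close>) and is closed under differentiation.\<close>

definition flat :: "real poly \<Rightarrow> real \<Rightarrow> real" where
  "flat P t = (if t > 0 then poly P (1 / t) * exp (- (1 / t)) else 0)"

lemma poly_times_exp_tendsto_0: "((\<lambda>y::real. poly P y * exp (- y)) \<longlongrightarrow> 0) at_top"
proof -
  have "((\<lambda>y::real. \<Sum>i\<le>degree P. coeff P i * (y ^ i / exp y)) \<longlongrightarrow> (\<Sum>i\<le>degree P. coeff P i * 0)) at_top"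
    by (intro tendsto_intros tendsto_power_div_exp_0)
  moreover have "(\<Sum>i\<le>degree P. coeff P i * (y ^ i / exp y)) = poly P y * exp (- y)" for y
    by (simp add: poly_altdef sum_distrib_right exp_minus divide_inverse mult.assoc)
  ultimately show ?thesis by simp
qed

text \<open>With s = 1/t, differentiating P(s) exp(-s) in t gives s^2 (P(s) - P'(s)) exp(-s), which
  explains the new polynomial. At 0 exponential decay beats every power of s.\<close>

lemma flat_has_derivative:
  "(flat P has_field_derivative flat ([:0, 0, 1:] * (P - pderiv P)) t) (at t)"
proof -
  consider "t > 0" | "t < 0" | "t = 0" by linarith
  then show ?thesis
  proof cases
    case 1
    have "((\<lambda>t. poly P (1 / t) * exp (- (1 / t))) has_field_derivative
             flat ([:0, 0, 1:] * (P - pderiv P)) t) (at t)"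
      using 1 by (auto intro!: derivative_eq_intros DERIV_chain2[OF poly_DERIV]
          simp: flat_def field_simps power2_eq_square)
    then show ?thesis
      by (rule has_field_derivative_transform_within_open[where S="{0<..}"])
        (use 1 in \<open>auto simp: flat_def\<close>)
  next
    case 2
    have "((\<lambda>t. 0) has_field_derivative flat ([:0, 0, 1:] * (P - pderiv P)) t) (at t)"
      using 2 by (auto simp: flat_def)
    then show ?thesis
      by (rule has_field_derivative_transform_within_open[where S="{..<0}"])
        (use 2 in \<open>auto simp: flat_def\<close>)
  next
    case 3
    \<comment> \<open>\<open>pCons 0 P\<close> carries one extra factor 1/h, which accounts for the
      division by \<open>h\<close> in the difference quotient at 0.\<close>
    have "((\<lambda>h. poly (pCons 0 P) (inverse h) * exp (- inverse h)) \<longlongrightarrow> 0) (at_right 0)"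
      using filterlim_compose[OF poly_times_exp_tendsto_0 filterlim_inverse_at_top_right] .
    then have "((\<lambda>h. flat P h / h) \<longlongrightarrow> 0) (at_right 0)"
      by (rule Lim_transform_eventually)
        (auto simp: eventually_at_filter flat_def field_simps)
    moreover have "((\<lambda>h. flat P h / h) \<longlongrightarrow> 0) (at_left 0)"
      by (rule tendsto_eventually) (auto simp: eventually_at_filter flat_def)
    ultimately have "((\<lambda>h. flat P h / h) \<longlongrightarrow> 0) (at 0)"
      by (simp add: filterlim_at_split)
    then show ?thesis
      using 3 by (simp add: has_field_derivative_iff flat_def)
  qed
qed

lemma smooth_flat: "smooth (flat P)"
proof -
  have "Ck k (flat P)" for k
  proof (induction k arbitrary: P)
    case 0
    show ?case
      using flat_has_derivative by (metis Ck.simps(1) DERIV_continuous_on has_field_derivative_at_within)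
  next
    case (Suc k)
    show ?case
      by (rule Ck_SucI, rule flat_has_derivative[unfolded has_field_derivative_def])
        (auto intro!: Ck_mult Suc Ck_const)
  qed
  then show ?thesis by (simp add: smooth_def)
qed

text \<open>Squaring the norm keeps the argument of \<open>flat\<close> smooth at the center
  \<open>c\<close>; the argument is positive exactly on the ball when \<open>r > 0\<close>.\<close>

definition ball_bump :: "'a::euclidean_space \<Rightarrow> real \<Rightarrow> 'a \<Rightarrow> real" where
  "ball_bump c r x = flat 1 (r\<^sup>2 - (norm (x - c))\<^sup>2)"

lemma smooth_ball_bump: "smooth (ball_bump c r)"
proof -
  have "smooth (\<lambda>x. r\<^sup>2 + (- 1) * (norm (x - c))\<^sup>2)"
    by (intro smooth_add smooth_mult smooth_const) (simp add: smooth_def Ck_norm_power2)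
  from smooth_compose[OF smooth_flat[of 1] this] show ?thesis
    by (simp add: ball_bump_def[abs_def])
qed

lemma ball_bump_nonneg: "0 \<le> ball_bump c r x"
  by (simp add: ball_bump_def flat_def)

lemma ball_bump_pos_iff:
  assumes "0 < r" shows "0 < ball_bump c r x \<longleftrightarrow> x \<in> ball c r"
proof -
  have "(norm (x - c))\<^sup>2 < r\<^sup>2 \<longleftrightarrow> norm (x - c) < r"
    using assms by (auto intro: power_strict_mono dest: power_less_imp_less_base)
  then show ?thesis
    by (simp add: ball_bump_def flat_def dist_norm norm_minus_commute)
qed

text \<open>A finite sum \<open>h\<close> of bumps covering \<open>K\<close> is positive on
  \<open>K\<close>, hence bounded below there by compactness. The map s to 1 - exp(-k s) squeezes it
  into the unit interval and keeps its zeros.\<close>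

lemma test_function_approx_indicator:
  fixes K :: "'a::euclidean_space set"
  assumes "compact K" "open V" "K \<subseteq> V" "0 < e"
  obtains \<phi> where "\<phi> \<in> test_functions V" "\<And>x. 0 \<le> \<phi> x" "\<And>x. \<phi> x \<le> 1"
    "\<And>x. x \<in> K \<Longrightarrow> 1 - e \<le> \<phi> x"
proof -
  have "\<forall>c\<in>K. \<exists>r>0. cball c r \<subseteq> V"
    using assms open_contains_cball by (metis subsetD)
  then obtain r where r: "\<And>c. c \<in> K \<Longrightarrow> 0 < r c" "\<And>c. c \<in> K \<Longrightarrow> cball c (r c) \<subseteq> V"
    by metis
  have "K \<subseteq> (\<Union>c\<in>K. ball c (r c))" using r(1) by force
  then obtain C where C: "C \<subseteq> K" "finite C" "K \<subseteq> (\<Union>c\<in>C. ball c (r c))"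
    using compactE_image[OF assms(1), of K "\<lambda>c. ball c (r c)"] by auto
  define h where "h x = (\<Sum>c\<in>C. ball_bump c (r c) x)" for x
  have h_smooth: "smooth h" unfolding h_def[abs_def] by (intro smooth_sum smooth_ball_bump)
  have h_nonneg: "0 \<le> h x" for x unfolding h_def by (intro sum_nonneg ball_bump_nonneg)
  have h_pos: "0 < h x" if "x \<in> K" for x
  proof -
    from that C obtain c where "c \<in> C" "x \<in> ball c (r c)" by auto
    then have "0 < ball_bump c (r c) x" using ball_bump_pos_iff r(1) C(1) by blast
    then show ?thesis unfolding h_def using \<open>c \<in> C\<close> C(2)
      by (intro sum_pos2[of C c]) (auto intro: ball_bump_nonneg)
  qed
  obtain m where m: "0 < m" "\<And>x. x \<in> K \<Longrightarrow> m \<le> h x"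
  proof (cases "K = {}")
    case False
    from continuous_attains_inf[OF assms(1) False smooth_continuous[OF h_smooth]]
    obtain x where "x \<in> K" "\<forall>y\<in>K. h x \<le> h y" by blast
    then show ?thesis using that h_pos by blast
  qed (use that[of 1] in auto)
  \<comment> \<open>The witness makes \<open>k * m\<close> equal to
    \<open>\<bar>ln e\<bar> + 1\<close>, which is at least -ln e; the absolute value and the 1 keep
    \<open>k\<close> positive for every \<open>e\<close>.\<close>
  obtain k where k: "0 < k" "exp (- (k * m)) \<le> e"
  proof
    show "0 < (\<bar>ln e\<bar> + 1) / m" using m by simp
    have "- (\<bar>ln e\<bar> + 1) \<le> ln e" by linarith
    then show "exp (- ((\<bar>ln e\<bar> + 1) / m * m)) \<le> e"
      using assms(4) m by (metis exp_le_cancel_iff exp_ln less_numeral_extra(3) nonzero_divide_eq_eq)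
  qed
  \<comment> \<open>\<open>h\<close> is at least \<open>m\<close> on \<open>K\<close>, so \<open>1 - exp (- k h)\<close> is close to 1 there for large \<open>k\<close>\<close>
  define \<phi> where "\<phi> x = 1 + (- 1) * exp ((- k) * h x)" for x
  have "smooth \<phi>" unfolding \<phi>_def[abs_def]
    by (intro smooth_add smooth_mult smooth_const smooth_compose[OF smooth_exp] h_smooth)
  define T where "T = (\<Union>c\<in>C. cball c (r c))"
  have "compact T" unfolding T_def using C by (intro compact_UN) auto
  have "{x. \<phi> x \<noteq> 0} \<subseteq> T"
  proof
    fix x assume "x \<in> {x. \<phi> x \<noteq> 0}"
    then have "h x \<noteq> 0" by (auto simp: \<phi>_def)
    then obtain c where c: "c \<in> C" "ball_bump c (r c) x \<noteq> 0"
      unfolding h_def by (meson sum.neutral)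
    then have "x \<in> ball c (r c)"
      using ball_bump_pos_iff[of "r c" c x] ball_bump_nonneg[of c "r c" x] r(1)[of c] C(1) by auto
    then show "x \<in> T" using c(1) by (auto simp: T_def intro!: bexI[of _ c])
  qed
  then have "closure {x. \<phi> x \<noteq> 0} \<subseteq> T"
    using \<open>compact T\<close> by (simp add: closure_minimal compact_imp_closed)
  moreover have "T \<subseteq> V" unfolding T_def using r C by blast
  moreover from calculation have "compact (closure {x. \<phi> x \<noteq> 0})"
    using \<open>compact T\<close> by (metis closed_closure compact_Int_closed inf.absorb_iff2)
  ultimately have "\<phi> \<in> test_functions V"
    using \<open>smooth \<phi>\<close> by (simp add: test_functions_def smooth_def)
  moreover have "0 \<le> \<phi> x" "\<phi> x \<le> 1" for x
    using h_nonneg[of x] k by (auto simp: \<phi>_def)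
  moreover have "1 - e \<le> \<phi> x" if "x \<in> K" for x
  proof -
    have "exp (- (k * h x)) \<le> exp (- (k * m))" using m(2)[OF that] k by simp
    also have "\<dots> \<le> e" by (rule k(2))
    finally show ?thesis by (simp add: \<phi>_def)
  qed
  ultimately show ?thesis by (rule that)
qed

section \<open>Test functions determine nonnegativity\<close>

lemma test_functionsD:
  assumes "\<phi> \<in> test_functions V"
  shows "smooth \<phi>" "compact (closure {x. \<phi> x \<noteq> 0})" "closure {x. \<phi> x \<noteq> 0} \<subseteq> V"
    "\<phi> x \<noteq> 0 \<Longrightarrow> x \<in> closure {x. \<phi> x \<noteq> 0}" "\<phi> x \<noteq> 0 \<Longrightarrow> x \<in> V"
  using assms closure_subset[of "{x. \<phi> x \<noteq> 0}"] by (auto simp: test_functions_def smooth_def)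

lemma test_functions_mono: "U \<subseteq> V \<Longrightarrow> test_functions U \<subseteq> test_functions V"
  by (auto simp: test_functions_def)

lemma test_function_bounded:
  assumes "\<phi> \<in> test_functions V"
  obtains B where "\<And>x. \<bar>\<phi> x\<bar> \<le> B"
proof -
  have "compact (\<phi> ` closure {x. \<phi> x \<noteq> 0})"
    using test_functionsD[OF assms] by (intro compact_continuous_image smooth_continuous)
  then obtain B where B: "\<And>x. x \<in> closure {x. \<phi> x \<noteq> 0} \<Longrightarrow> \<bar>\<phi> x\<bar> \<le> B"
    by (metis bounded_iff compact_imp_bounded image_eqI real_norm_def)
  have "\<bar>\<phi> x\<bar> \<le> max B 0" for x
    using B[of x] test_functionsD(4)[OF assms, of x] by (cases "\<phi> x = 0") auto
  then show ?thesis by (rule that)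
qed

section \<open>Integrals over open sets and local integrability\<close>

lemma integral_lebesgue_on_eq:
  fixes f :: "'a::euclidean_space \<Rightarrow> 'b::euclidean_space"
  assumes "open U"
  shows "(LINT x|lebesgue_on U. f x) = (LINT x|lebesgue. indicator U x *\<^sub>R f x)"
  using assms by (intro integral_restrict_space) simp

lemma integrable_lebesgue_on_iff:
  fixes f :: "'a::euclidean_space \<Rightarrow> 'b::euclidean_space"
  assumes "open U"
  shows "integrable (lebesgue_on U) f \<longleftrightarrow> integrable lebesgue (\<lambda>x. indicator U x *\<^sub>R f x)"
  using assms by (intro integrable_restrict_space) simp

lemma integral_lebesgue_on_support:
  fixes f :: "'a::euclidean_space \<Rightarrow> real"
  assumes "open U" "open V" "\<And>x. f x \<noteq> 0 \<Longrightarrow> x \<in> U \<and> x \<in> V"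
  shows "(LINT x|lebesgue_on U. f x) = (LINT x|lebesgue_on V. f x)"
  unfolding integral_lebesgue_on_eq[OF assms(1)] integral_lebesgue_on_eq[OF assms(2)]
  by (rule Bochner_Integration.integral_cong) (use assms(3) in \<open>auto simp: indicator_def\<close>)

lemma locally_integrable_inner:
  "locally_integrable U g \<Longrightarrow> locally_integrable U (\<lambda>x. g x \<bullet> w)"
  unfolding locally_integrable_def set_integrable_def
proof (intro allI impI)
  fix K assume "\<forall>K. compact K \<and> K \<subseteq> U \<longrightarrow> integrable lebesgue (\<lambda>x. indicator K x *\<^sub>R g x)"
    and "compact K \<and> K \<subseteq> U"
  then have "integrable lebesgue (\<lambda>x. (indicator K x *\<^sub>R g x) \<bullet> w)"
    by (intro integrable_inner_left) auto
  then show "integrable lebesgue (\<lambda>x. indicator K x *\<^sub>R (g x \<bullet> w))" by simp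
qed

lemma locally_integrable_diff:
  fixes f g :: "'a::euclidean_space \<Rightarrow> real"
  shows "locally_integrable U f \<Longrightarrow> locally_integrable U g \<Longrightarrow> locally_integrable U (\<lambda>x. f x - g x)"
  unfolding locally_integrable_def by (auto intro: set_integral_diff(1))

lemma locally_integrable_continuous:
  fixes f :: "'a::euclidean_space \<Rightarrow> 'b::euclidean_space"
  assumes "continuous_on U f"
  shows "locally_integrable U f"
  unfolding locally_integrable_def
proof (intro allI impI)
  fix K assume K: "compact K \<and> K \<subseteq> U"
  then have "set_integrable lborel K f"
    using assms borel_integrable_compact continuous_on_subset unfolding set_integrable_def by blast
  then show "set_integrable lebesgue K f"
    unfolding set_integrable_def by (subst integrable_completion) auto
qed

lemma integrable_mult_test_function:
  fixes f :: "'a::euclidean_space \<Rightarrow> real"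
  assumes "open U" "locally_integrable U f" "\<phi> \<in> test_functions U"
  shows "integrable (lebesgue_on U) (\<lambda>x. f x * \<phi> x)"
proof -
  define K where "K = closure {x. \<phi> x \<noteq> 0}"
  have K: "compact K" "K \<subseteq> U" "\<And>x. \<phi> x \<noteq> 0 \<Longrightarrow> x \<in> K"
    using test_functionsD[OF assms(3)] by (auto simp: K_def)
  obtain B where B: "\<And>x. \<bar>\<phi> x\<bar> \<le> B" using test_function_bounded[OF assms(3)] by blast
  have f: "integrable lebesgue (\<lambda>x. indicator K x *\<^sub>R f x)"
    using assms(2) K unfolding locally_integrable_def set_integrable_def by blast
  have [measurable]: "\<phi> \<in> borel_measurable lebesgue"
    using smooth_continuous[OF test_functionsD(1)[OF assms(3)], of UNIV]
    by (simp add: borel_measurable_continuous_onI measurable_completion)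
  note [measurable] = borel_measurable_integrable[OF f]
  have "integrable lebesgue (\<lambda>x. (indicator K x *\<^sub>R f x) * \<phi> x)"
  proof (rule Bochner_Integration.integrable_bound)
    show "integrable lebesgue (\<lambda>x. B * (indicator K x *\<^sub>R f x))"
      using f by simp
    have "\<bar>\<phi> x\<bar> \<le> \<bar>B\<bar>" for x using B[of x] by linarith
    then show "AE x in lebesgue. norm ((indicator K x *\<^sub>R f x) * \<phi> x) \<le> norm (B * (indicator K x *\<^sub>R f x))"
      by (auto simp: abs_mult mult.commute intro!: mult_right_mono AE_I2 simp: indicator_def)
  qed measurable
  also have "(\<lambda>x. (indicator K x *\<^sub>R f x) * \<phi> x) = (\<lambda>x. indicator U x *\<^sub>R (f x * \<phi> x))"
    using K by (auto simp: fun_eq_iff indicator_def)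
  finally show ?thesis by (simp add: integrable_lebesgue_on_iff[OF assms(1)])
qed

text \<open>On an exhaustion of \<open>U\<close> by compact sets the truncations are integrable, and
  they converge pointwise to \<open>f\<close> extended by zero.\<close>

lemma locally_integrable_measurable:
  fixes f :: "'a::euclidean_space \<Rightarrow> 'b::euclidean_space"
  assumes "open U" "locally_integrable U f"
  shows "f \<in> borel_measurable (lebesgue_on U)"
proof -
  obtain C where C: "\<And>n::nat. compact (C n)" "\<And>n. C n \<subseteq> U"
    "\<And>K. \<lbrakk>compact K; K \<subseteq> U\<rbrakk> \<Longrightarrow> \<exists>N. \<forall>n\<ge>N. K \<subseteq> C n"
    using open_Union_compact_subsets[OF assms(1)] by metis
  have "(\<lambda>x. indicator U x *\<^sub>R f x) \<in> borel_measurable lebesgue"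
  proof (rule borel_measurable_LIMSEQ_metric)
    show "(\<lambda>x. indicator (C n) x *\<^sub>R f x) \<in> borel_measurable lebesgue" for n
      using assms(2) C unfolding locally_integrable_def set_integrable_def
      by (blast intro: borel_measurable_integrable)
    show "(\<lambda>n. indicator (C n) x *\<^sub>R f x) \<longlonglongrightarrow> indicator U x *\<^sub>R f x" for x
    proof (cases "x \<in> U")
      case True
      with C(3)[of "{x}"] obtain N where "\<forall>n\<ge>N. x \<in> C n" by auto
      then show ?thesis using True
        by (intro tendsto_eventually) (auto simp: eventually_sequentially indicator_def)
    next
      case False
      then have "x \<notin> C n" for n using C(2) by blast
      then show ?thesis using False by simp
    qed
  qed
  then show ?thesis
    using assms(1) by (subst borel_measurable_restrict_space_iff) auto
qed

text \<open>Inner regularity: a closed subset exhausts \<open>E\<close> up to measure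
  \<open>e\<close>, and cutting it with balls writes it as a countable union of compact, hence null,
  sets.\<close>

lemma null_sets_lebesgue_if_compact_subsets_null:
  fixes E :: "'a::euclidean_space set"
  assumes "E \<in> sets lebesgue" "\<And>K. compact K \<Longrightarrow> K \<subseteq> E \<Longrightarrow> K \<in> null_sets lebesgue"
  shows "E \<in> null_sets lebesgue"
proof -
  have "emeasure lebesgue E \<le> 0 + ennreal e" if e: "e > 0" for e
  proof -
    obtain T where T: "closed T" "T \<subseteq> E" "E - T \<in> lmeasurable" "emeasure lebesgue (E - T) < ennreal e"
      using sets_lebesgue_inner_closed[OF assms(1) e] .
    have "(\<Union>n::nat. T \<inter> cball 0 (real n)) \<in> null_sets lebesgue"
      using T by (intro null_sets_UN assms(2)) (auto intro: closed_Int_compact)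
    moreover have "(\<Union>n::nat. T \<inter> cball 0 (real n)) = T"
      by (auto simp: real_arch_simple)
    ultimately have "T \<in> null_sets lebesgue" by simp
    then have "emeasure lebesgue (E - T) = emeasure lebesgue E"
      using assms(1) by (intro emeasure_Diff_null_set)
    then show ?thesis using T(4) by simp
  qed
  then have "emeasure lebesgue E \<le> 0" by (rule ennreal_le_epsilon)
  then show ?thesis using assms(1) by (simp add: null_sets_def)
qed

text \<open>Test functions shrinking to the indicator of a compact \<open>K\<close> show that the
  integral of \<open>f\<close> over \<open>K\<close> is nonnegative. If \<open>f < 0\<close> on
  \<open>K\<close>, this forces \<open>K\<close> to be null, and inner regularity passes to the
  whole set where \<open>f\<close> is negative.\<close>

lemma AE_nonneg_if_test_integrals_nonneg:
  fixes f :: "'a::euclidean_space \<Rightarrow> real"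
  assumes U: "open U" and f: "locally_integrable U f"
    and pos: "\<And>\<phi>. \<phi> \<in> test_functions U \<Longrightarrow> (\<And>x. 0 \<le> \<phi> x) \<Longrightarrow> 0 \<le> (LINT x|lebesgue_on U. f x * \<phi> x)"
  shows "AE x in lebesgue_on U. 0 \<le> f x"
proof -
  \<comment> \<open>approximate the indicator of \<open>K\<close> by test functions supported in shrinking neighbourhoods\<close>
  have compact_nonneg: "0 \<le> (LINT x|lebesgue. indicator K x *\<^sub>R f x)"
    if K: "compact K" "K \<subseteq> U" "K \<noteq> {}" for K
  proof -
    obtain e where e: "e > 0" "(\<Union>x\<in>K. cball x e) \<subseteq> U"
      using compact_subset_open_imp_cball_epsilon_subset[OF K(1) U K(2)] .
    \<comment> \<open>All supports will lie in this compact neighbourhood of \<open>K\<close>, so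
      \<bar>f\<bar> restricted to \<open>K'\<close> is the integrable majorant.\<close>
    define K' where "K' = {x. infdist x K \<le> e}"
    have "compact K'" unfolding K'_def using K e by (intro compact_infdist_le) auto
    have "K' \<subseteq> U"
    proof
      fix x assume "x \<in> K'"
      obtain y where "y \<in> K" "infdist x K = dist x y"
        using infdist_attains_inf[of K x] K compact_imp_closed by blast
      with \<open>x \<in> K'\<close> show "x \<in> U" using e(2) by (force simp: K'_def dist_commute)
    qed
    define V where "V n = {x. infdist x K < e / real (Suc n)}" for n
    have V: "open (V n)" "K \<subseteq> V n" "V n \<subseteq> K'" for n
    proof -
      show "open (V n)" unfolding V_def by (intro open_Collect_less continuous_intros)
      show "K \<subseteq> V n" using e by (auto simp: V_def)
      have "e / real (Suc n) \<le> e" using e by (simp add: field_simps)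
      then show "V n \<subseteq> K'" by (auto simp: V_def K'_def)
    qed
    have "\<forall>n. \<exists>\<phi>. \<phi> \<in> test_functions (V n) \<and> (\<forall>x. 0 \<le> \<phi> x \<and> \<phi> x \<le> 1) \<and>
            (\<forall>x\<in>K. 1 - 1 / real (Suc n) \<le> \<phi> x)"
      by (meson V(1) V(2) K(1) test_function_approx_indicator of_nat_0_less_iff zero_less_Suc
          zero_less_divide_1_iff)
    then obtain \<phi> where \<phi>: "\<And>n. \<phi> n \<in> test_functions (V n)" "\<And>n x. 0 \<le> \<phi> n x" "\<And>n x. \<phi> n x \<le> 1"
      "\<And>n x. x \<in> K \<Longrightarrow> 1 - 1 / real (Suc n) \<le> \<phi> n x" by metis
    have test: "\<phi> n \<in> test_functions U" for n
      using \<phi>(1)[of n] V(3)[of n] \<open>K' \<subseteq> U\<close> test_functions_mono[of "V n" U] by blast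
    have int: "integrable lebesgue (\<lambda>x. indicator U x *\<^sub>R (f x * \<phi> n x))" for n
      by (rule iffD1[OF integrable_lebesgue_on_iff[OF U] integrable_mult_test_function[OF U f test]])
    have int': "integrable lebesgue (\<lambda>x. indicator S x *\<^sub>R f x)" if "compact S" "S \<subseteq> U" for S
      using f that unfolding locally_integrable_def set_integrable_def by blast
    have "(\<lambda>n. LINT x|lebesgue. indicator U x *\<^sub>R (f x * \<phi> n x))
             \<longlonglongrightarrow> (LINT x|lebesgue. indicator K x *\<^sub>R f x)"
    proof (rule integral_dominated_convergence[where w = "\<lambda>x. \<bar>indicator K' x *\<^sub>R f x\<bar>"])
      show "integrable lebesgue (\<lambda>x. \<bar>indicator K' x *\<^sub>R f x\<bar>)"
        using int'[OF \<open>compact K'\<close> \<open>K' \<subseteq> U\<close>] by (rule integrable_abs)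
      show "(\<lambda>x. indicator K x *\<^sub>R f x) \<in> borel_measurable lebesgue"
        using int'[OF K(1,2)] by simp
      show "(\<lambda>x. indicator U x *\<^sub>R (f x * \<phi> n x)) \<in> borel_measurable lebesgue" for n
        using int[of n] by simp
      show "AE x in lebesgue. norm (indicator U x *\<^sub>R (f x * \<phi> n x)) \<le> \<bar>indicator K' x *\<^sub>R f x\<bar>" for n
      proof (rule AE_I2)
        fix x
        have "\<bar>f x\<bar> * \<phi> n x \<le> \<bar>f x\<bar> * 1" using \<phi>(2,3)[where x=x] by (intro mult_left_mono) auto
        then show "norm (indicator U x *\<^sub>R (f x * \<phi> n x)) \<le> \<bar>indicator K' x *\<^sub>R f x\<bar>"
          using test_functionsD(5)[OF \<phi>(1), of n x] V(3)[of n] \<phi>(2)[of n x]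
          by (cases "\<phi> n x = 0") (auto simp: abs_mult indicator_def)
      qed
      have "(\<lambda>n. indicator U x *\<^sub>R (f x * \<phi> n x)) \<longlonglongrightarrow> indicator K x *\<^sub>R f x" for x
      proof (cases "x \<in> K")
        case True
        have "(\<lambda>n. 1 / real (Suc n)) \<longlonglongrightarrow> 0" by (rule lim_1_over_n[THEN LIMSEQ_Suc])
        then have "(\<lambda>n. 1 - 1 / real (Suc n)) \<longlonglongrightarrow> 1 - 0" by (intro tendsto_diff tendsto_const)
        then have "(\<lambda>n. \<phi> n x) \<longlonglongrightarrow> 1"
          by (intro tendsto_sandwich[where g = "\<lambda>n. \<phi> n x" and f = "\<lambda>n. 1 - 1 / real (Suc n)"
                and h = "\<lambda>n. 1" and c = 1]) (use \<phi> True in auto)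
        then have "(\<lambda>n. indicator U x *\<^sub>R (f x * \<phi> n x)) \<longlonglongrightarrow> indicator U x *\<^sub>R (f x * 1)"
          by (intro tendsto_intros)
        then show ?thesis using True K(2) by (auto simp: indicator_def)
      next
        case False
        then have "0 < infdist x K"
          using K compact_imp_closed in_closed_iff_infdist_zero infdist_nonneg
          by (metis order_less_le)
        \<comment> \<open>From index \<open>N\<close> on, \<open>x\<close> lies outside
          \<open>V n\<close>, so the approximating functions vanish at \<open>x\<close>.\<close>
        then obtain N where "1 / real (Suc N) < infdist x K / e"
          using e(1) nat_approx_posE[of "infdist x K / e"] by (auto simp del: of_nat_Suc)
        then have N: "e / real (Suc N) < infdist x K"
          using e(1) by (simp add: field_simps)
        have "\<phi> n x = 0" if "n \<ge> N" for n
        proof -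
          have "e / real (Suc n) \<le> e / real (Suc N)" using e(1) that by (intro divide_left_mono) auto
          then have "x \<notin> V n" using N by (auto simp: V_def)
          then show ?thesis using test_functionsD(5)[OF \<phi>(1)] by blast
        qed
        then show ?thesis using False
          by (intro tendsto_eventually) (auto simp: eventually_sequentially intro!: exI[of _ N])
      qed
      then show "AE x in lebesgue. (\<lambda>n. indicator U x *\<^sub>R (f x * \<phi> n x)) \<longlonglongrightarrow> indicator K x *\<^sub>R f x"
        by simp
    qed
    moreover have "0 \<le> (LINT x|lebesgue. indicator U x *\<^sub>R (f x * \<phi> n x))" for n
      using pos[OF test \<phi>(2)] unfolding integral_lebesgue_on_eq[OF U] .
    ultimately show ?thesis by (intro LIMSEQ_le_const) auto
  qed
  define E where "E = {x \<in> U. f x < 0}"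
  have "(\<lambda>x. indicator U x *\<^sub>R f x) \<in> borel_measurable lebesgue"
    using locally_integrable_measurable[OF U f] U
    by (subst (asm) borel_measurable_restrict_space_iff) auto
  then have "{x \<in> space lebesgue. indicator U x *\<^sub>R f x < 0} \<in> sets lebesgue" by measurable
  moreover have "{x \<in> space lebesgue. indicator U x *\<^sub>R f x < 0} = E"
    by (auto simp: E_def indicator_def split: if_splits)
  ultimately have "E \<in> sets lebesgue" by simp
  moreover have "K \<in> null_sets lebesgue" if K: "compact K" "K \<subseteq> E" for K
  proof (cases "K = {}")
    case False
    have "K \<subseteq> U" using K by (auto simp: E_def)
    then have int: "integrable lebesgue (\<lambda>x. indicator K x *\<^sub>R f x)"
      using f K unfolding locally_integrable_def set_integrable_def by blast
    have nonpos: "AE x in lebesgue. 0 \<le> - (indicator K x *\<^sub>R f x)"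
      using K by (intro AE_I2) (auto simp: E_def indicator_def)
    \<comment> \<open>The integrand is nonnegative because \<open>f < 0\<close> on \<open>K\<close>,
      while \<open>compact_nonneg\<close> makes its integral nonpositive.\<close>
    have "(LINT x|lebesgue. - (indicator K x *\<^sub>R f x)) = 0"
      using compact_nonneg[OF K(1) \<open>K \<subseteq> U\<close> False] integral_nonneg_AE[OF nonpos]
      by (metis Bochner_Integration.integral_minus neg_le_0_iff_le order_antisym)
    then have "AE x in lebesgue. - (indicator K x *\<^sub>R f x) = 0"
      using integral_nonneg_eq_0_iff_AE[OF integrable_minus[OF int] nonpos] by simp
    then have "AE x in lebesgue. x \<notin> K"
      by eventually_elim (use K in \<open>auto simp: E_def indicator_def split: if_splits\<close>)
    then show ?thesis using K(1) by (simp add: AE_iff_null_sets compact_imp_closed)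
  qed auto
  ultimately have "E \<in> null_sets lebesgue" by (rule null_sets_lebesgue_if_compact_subsets_null)
  then have "AE x in lebesgue. x \<notin> E" by (rule AE_not_in)
  then have "AE x in lebesgue. x \<in> U \<longrightarrow> 0 \<le> f x"
    by eventually_elim (auto simp: E_def)
  then show ?thesis using U by (subst AE_restrict_space_iff) auto
qed

text \<open>Translation invariance of \<open>lborel\<close>, available because the integrand
  extended by zero is Borel. The support condition makes both integrands vanish off
  \<open>U\<close>, so the domain need not move.\<close>

lemma integral_shift_test:
  fixes v \<psi> :: "'a::euclidean_space \<Rightarrow> real"
  assumes U: "open U" and v: "continuous_on U v" and \<psi>: "continuous_on UNIV \<psi>"
    and supp: "\<And>z. \<psi> z \<noteq> 0 \<Longrightarrow> z \<in> U \<and> z + w \<in> U"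
  shows "(LINT z|lebesgue_on U. v z * \<psi> (z - w)) = (LINT z|lebesgue_on U. v (z + w) * \<psi> z)"
proof -
  define F where "F z = indicator U z *\<^sub>R (v z * \<psi> (z - w))" for z
  have F: "F \<in> borel_measurable borel" unfolding F_def[abs_def]
    using U by (intro borel_measurable_continuous_on_indicator continuous_intros v
        continuous_on_compose2[OF \<psi>]) auto
  have eq: "F (w + z) = indicator U z *\<^sub>R (v (z + w) * \<psi> z)" for z
    using supp[of z] by (cases "\<psi> z = 0") (auto simp: F_def add.commute)
  have "(LINT z|lebesgue_on U. v z * \<psi> (z - w)) = (LINT z|lborel. F z)"
    using F unfolding integral_lebesgue_on_eq[OF U] F_def[symmetric] by (subst integral_completion) auto
  also have "\<dots> = (LINT z|distr lborel borel ((+) w). F z)"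
    by (simp add: lborel_distr_plus)
  also have "\<dots> = (LINT z|lborel. F (w + z))"
    using F by (intro integral_distr) auto
  also have "\<dots> = (LINT z|lebesgue. F (w + z))"
    using F by (subst integral_completion) auto
  also have "\<dots> = (LINT z|lebesgue_on U. v (z + w) * \<psi> z)"
    unfolding integral_lebesgue_on_eq[OF U] eq ..
  finally show ?thesis .
qed

text \<open>The set where \<open>f < 0\<close> is open by continuity, and a nonempty open set is not
  negligible.\<close>

lemma AE_open_imp_all:
  fixes f :: "'a::euclidean_space \<Rightarrow> real"
  assumes U: "open U" and f: "continuous_on U f" and "AE x in lebesgue_on U. 0 \<le> f x" "x \<in> U"
  shows "0 \<le> f x"
proof (rule ccontr)
  assume "\<not> 0 \<le> f x"
  define E where "E = {x \<in> U. f x < 0}"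
  have "open E" unfolding E_def
    using continuous_open_preimage[OF f U, of "{..<0}"] by (simp add: vimage_def Int_def)
  have "x \<in> E" using \<open>\<not> 0 \<le> f x\<close> assms by (simp add: E_def)
  have "AE x in lebesgue. x \<in> U \<longrightarrow> 0 \<le> f x"
    using assms(3) U by (subst (asm) AE_restrict_space_iff) auto
  then have "AE x in lebesgue. x \<notin> E" by eventually_elim (auto simp: E_def)
  then have "E \<in> null_sets lebesgue" using \<open>open E\<close> by (simp add: AE_iff_null_sets)
  then have "negligible E" by (simp add: negligible_iff_null_sets)
  then show False using open_not_negligible[OF \<open>open E\<close>] \<open>x \<in> E\<close> by auto
qed

section \<open>Weak gradients and Lipschitz bounds\<close>

lemma frechet_derivative_expand:
  fixes \<phi> :: "'a::euclidean_space \<Rightarrow> real"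
  assumes "smooth \<phi>"
  shows "frechet_derivative \<phi> (at x) w = (\<Sum>b\<in>Basis. (w \<bullet> b) * frechet_derivative \<phi> (at x) b)"
proof -
  have lin: "linear (frechet_derivative \<phi> (at x))"
    using has_derivative_linear[OF smooth_has_derivative[OF assms]] .
  have "frechet_derivative \<phi> (at x) w = frechet_derivative \<phi> (at x) (\<Sum>b\<in>Basis. (w \<bullet> b) *\<^sub>R b)"
    by (simp add: euclidean_representation)
  also have "\<dots> = (\<Sum>b\<in>Basis. (w \<bullet> b) * frechet_derivative \<phi> (at x) b)"
    by (simp add: linear_sum[OF lin] linear_scale[OF lin])
  finally show ?thesis .
qed

text \<open>Off the closed support of \<open>\<phi>\<close> the function is locally zero, so
  differentiation does not enlarge the support.\<close>

lemma test_functions_partial: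
  assumes "\<phi> \<in> test_functions V" "b \<in> Basis"
  shows "(\<lambda>x. frechet_derivative \<phi> (at x) b) \<in> test_functions V"
proof -
  note \<phi> = test_functionsD[OF assms(1)]
  let ?S = "closure {x. \<phi> x \<noteq> 0}"
  have "frechet_derivative \<phi> (at x) = (\<lambda>h. 0)" if "x \<notin> ?S" for x
  proof -
    have "((\<lambda>x. 0) has_derivative (\<lambda>h. 0)) (at x)" by simp
    then have "(\<phi> has_derivative (\<lambda>h. 0)) (at x)"
    proof (rule has_derivative_transform_within_open)
      show "open (- ?S)" by (intro open_Compl closed_closure)
      show "x \<in> - ?S" using that by simp
      show "0 = \<phi> y" if "y \<in> - ?S" for y using \<phi>(4)[of y] that by auto
    qed
    then show ?thesis by (rule frechet_derivative_at[symmetric])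
  qed
  then have "{x. frechet_derivative \<phi> (at x) b \<noteq> 0} \<subseteq> ?S" by force
  then have sub: "closure {x. frechet_derivative \<phi> (at x) b \<noteq> 0} \<subseteq> ?S"
    by (simp add: closure_minimal)
  then have "compact (closure {x. frechet_derivative \<phi> (at x) b \<noteq> 0})"
    using \<phi>(2) by (metis closed_closure compact_Int_closed inf.absorb_iff2)
  with sub \<phi>(3) smooth_partial[OF \<phi>(1) assms(2)] show ?thesis
    by (auto simp: test_functions_def smooth_def)
qed

lemma test_functions_translate:
  assumes "\<phi> \<in> test_functions V" "\<And>z. z \<in> closure {x. \<phi> x \<noteq> 0} \<Longrightarrow> z + a \<in> W"
  shows "(\<lambda>x. \<phi> (x - a)) \<in> test_functions W"
proof -
  note \<phi> = test_functionsD[OF assms(1)]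
  have "{x. \<phi> (x - a) \<noteq> 0} = (+) a ` {x. \<phi> x \<noteq> 0}"
    by (auto intro!: image_eqI[where x = "x - a" for x])
  then have eq: "closure {x. \<phi> (x - a) \<noteq> 0} = (+) a ` closure {x. \<phi> x \<noteq> 0}"
    by (simp add: closure_translation)
  have "compact (closure {x. \<phi> (x - a) \<noteq> 0})"
    unfolding eq using \<phi>(2) by (rule compact_translation)
  moreover have "closure {x. \<phi> (x - a) \<noteq> 0} \<subseteq> W"
    unfolding eq using assms(2) by (auto simp: add.commute)
  ultimately show ?thesis
    using \<phi>(1) Ck_translate[of _ \<phi> a] by (simp add: test_functions_def smooth_def)
qed

lemma frechet_derivative_translate:
  assumes "smooth \<phi>"
  shows "frechet_derivative (\<lambda>x. \<phi> (x - a)) (at x) = frechet_derivative \<phi> (at (x - a))"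
proof -
  have "((\<lambda>x. \<phi> (x - a)) has_derivative frechet_derivative \<phi> (at (x - a))) (at x)"
  proof (rule has_derivative_compose[of "\<lambda>x. x - a" "\<lambda>h. h" x UNIV, simplified])
    show "((\<lambda>x. x - a) has_derivative (\<lambda>h. h)) (at x)"
      by (auto intro!: derivative_eq_intros)
  qed (rule smooth_has_derivative[OF assms])
  then show ?thesis by (rule frechet_derivative_at[symmetric])
qed

text \<open>The partial derivatives are test functions and hence bounded; the sum of their bounds
  controls the operator norm, and the mean value inequality applies on the whole space.\<close>

lemma test_function_lipschitz:
  assumes "\<phi> \<in> test_functions V"
  obtains C where "\<And>x y. \<bar>\<phi> y - \<phi> x\<bar> \<le> C * norm (y - x)"
proof -
  note \<phi> = test_functionsD[OF assms]
  have "\<forall>b\<in>Basis. \<exists>B. \<forall>x. \<bar>frechet_derivative \<phi> (at x) b\<bar> \<le> B"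
    using test_function_bounded[OF test_functions_partial[OF assms]] by metis
  then obtain B where B: "\<And>b x. b \<in> Basis \<Longrightarrow> \<bar>frechet_derivative \<phi> (at x) b\<bar> \<le> B b"
    by metis
  have onorm: "onorm (frechet_derivative \<phi> (at x)) \<le> sum B Basis" for x
  proof (rule onorm_le)
    fix w
    have "\<bar>(w \<bullet> b) * frechet_derivative \<phi> (at x) b\<bar> \<le> norm w * B b" if "b \<in> Basis" for b
      unfolding abs_mult using B[OF that, of x] Basis_le_norm[OF that, of w]
      by (intro mult_mono) auto
    then show "norm (frechet_derivative \<phi> (at x) w) \<le> sum B Basis * norm w"
      unfolding frechet_derivative_expand[OF \<phi>(1), of x w] sum_distrib_right mult.commute[of _ "norm w"]
      by (auto simp: sum_distrib_left intro!: order_trans[OF sum_abs] sum_mono)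
  qed
  have "norm (\<phi> y - \<phi> x) \<le> sum B Basis * norm (y - x)" for x y
    by (rule differentiable_bound[OF convex_UNIV _ onorm])
      (auto intro: smooth_has_derivative[OF \<phi>(1)])
  then show ?thesis by (intro that) simp
qed

text \<open>Both sides are linear in \<open>w\<close>, so the identity passes from basis vectors to
  all directions; local integrability allows the sums to be split.\<close>

lemma has_weak_gradient_directional:
  assumes U: "open U" and g: "has_weak_gradient U u g" and \<phi>: "\<phi> \<in> test_functions U"
  shows "(LINT x|lebesgue_on U. u x * frechet_derivative \<phi> (at x) w)
           = - (LINT x|lebesgue_on U. (g x \<bullet> w) * \<phi> x)"
proof -
  have lu: "locally_integrable U u" and lg: "locally_integrable U g"
    using g by (auto simp: has_weak_gradient_def)
  have "(LINT x|lebesgue_on U. u x * frechet_derivative \<phi> (at x) w)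
      = (LINT x|lebesgue_on U. (\<Sum>b\<in>Basis. (w \<bullet> b) * (u x * frechet_derivative \<phi> (at x) b)))"
    unfolding frechet_derivative_expand[OF test_functionsD(1)[OF \<phi>], of _ w]
    by (simp add: sum_distrib_left mult.left_commute)
  also have "\<dots> = (\<Sum>b\<in>Basis. (w \<bullet> b) * (LINT x|lebesgue_on U. u x * frechet_derivative \<phi> (at x) b))"
    by (subst Bochner_Integration.integral_sum)
      (auto intro!: integrable_mult_test_function[OF U lu] test_functions_partial[OF \<phi>])
  also have "\<dots> = (\<Sum>b\<in>Basis. - ((w \<bullet> b) * (LINT x|lebesgue_on U. (g x \<bullet> b) * \<phi> x)))"
    using g \<phi> by (intro sum.cong) (auto simp: has_weak_gradient_def)
  also have "\<dots> = - (LINT x|lebesgue_on U. (\<Sum>b\<in>Basis. (w \<bullet> b) * ((g x \<bullet> b) * \<phi> x)))"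
    by (subst Bochner_Integration.integral_sum)
      (auto intro!: integrable_mult_test_function[OF U locally_integrable_inner[OF lg] \<phi>]
        simp: sum_negf)
  also have "(\<lambda>x. \<Sum>b\<in>Basis. (w \<bullet> b) * ((g x \<bullet> b) * \<phi> x)) = (\<lambda>x. (g x \<bullet> w) * \<phi> x)"
    by (rule ext, subst euclidean_inner[of "g _" w]) (simp add: sum_distrib_left mult_ac)
  finally show ?thesis .
qed

section \<open>Integrals against translated test functions\<close>

lemma integrable_bounded_continuous:
  fixes f :: "'a::euclidean_space \<Rightarrow> real"
  assumes "open U" "bounded U" "continuous_on U f" "\<And>x. x \<in> U \<Longrightarrow> \<bar>f x\<bar> \<le> B"
  shows "integrable (lebesgue_on U) f"
proof (rule finite_measure.integrable_const_bound)
  show "finite_measure (lebesgue_on U)"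
    using assms by (intro finite_measure_lebesgue_on bounded_set_imp_lmeasurable) auto
  show "AE x in lebesgue_on U. norm (f x) \<le> B"
    using assms(4) by (intro AE_I2) simp
  show "f \<in> borel_measurable (lebesgue_on U)"
    using assms by (intro continuous_imp_measurable_on_sets_lebesgue) auto
qed

text \<open>Differentiation under the integral sign. The Lipschitz constant \<open>C\<close> of
  \<open>\<psi>\<close> bounds the quotients by the constant \<open>B * (C * norm w)\<close>,
  integrable because \<open>U\<close> is bounded.\<close>

lemma integral_translate_test_has_derivative:
  fixes v \<psi> :: "'a::euclidean_space \<Rightarrow> real"
  assumes U: "open U" "bounded U" and v: "continuous_on U v" "\<And>x. x \<in> U \<Longrightarrow> \<bar>v x\<bar> \<le> B"
    and \<psi>: "\<psi> \<in> test_functions V"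
  shows "((\<lambda>t. LINT z|lebesgue_on U. v z * \<psi> (z - t *\<^sub>R w)) has_real_derivative
     - (LINT z|lebesgue_on U. v z * frechet_derivative \<psi> (at (z - t *\<^sub>R w)) w)) (at t)"
    (is "(?H has_real_derivative ?D) _")
proof -
  note \<psi>' = test_functionsD[OF \<psi>]
  obtain C where C: "\<And>x y. \<bar>\<psi> y - \<psi> x\<bar> \<le> C * norm (y - x)" using test_function_lipschitz[OF \<psi>] by blast
  obtain P where P: "\<And>x. \<bar>\<psi> x\<bar> \<le> P" using test_function_bounded[OF \<psi>] by blast
  have cont: "continuous_on U (\<lambda>z. v z * \<psi> (z - a))" for a
    by (intro continuous_intros v continuous_on_compose2[OF smooth_continuous[OF \<psi>'(1), of UNIV]]) auto
  have int: "integrable (lebesgue_on U) (\<lambda>z. v z * \<psi> (z - a))" for a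
  proof (rule integrable_bounded_continuous[OF U cont])
    show "\<bar>v x * \<psi> (x - a)\<bar> \<le> B * P" if "x \<in> U" for x
      unfolding abs_mult using v(2)[OF that] P[of "x - a"] by (intro mult_mono) auto
  qed
  have deriv: "((\<lambda>s. \<psi> (z - s *\<^sub>R w)) has_real_derivative
      - frechet_derivative \<psi> (at (z - t *\<^sub>R w)) w) (at t)" for z
  proof -
    have lin: "linear (frechet_derivative \<psi> (at (z - t *\<^sub>R w)))"
      using has_derivative_linear[OF smooth_has_derivative[OF \<psi>'(1)]] .
    have "((\<lambda>s. \<psi> (z - s *\<^sub>R w)) has_derivative
        (\<lambda>h. frechet_derivative \<psi> (at (z - t *\<^sub>R w)) (- (h *\<^sub>R w)))) (at t)"
      by (rule has_derivative_compose[OF _ smooth_has_derivative[OF \<psi>'(1)]])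
        (auto intro!: derivative_eq_intros)
    then show ?thesis
      unfolding has_field_derivative_def
      by (rule has_derivative_eq_rhs) (simp add: fun_eq_iff linear_neg[OF lin] linear_scale[OF lin])
  qed
  have "((\<lambda>h. (?H (t + h) - ?H t) / h) \<longlongrightarrow> ?D) (at 0)"
    unfolding tendsto_at_iff_sequentially
  proof (intro allI impI)
    \<comment> \<open>Dominated convergence is a statement about sequences, so the limit is tested
      along arbitrary null sequences with nonzero terms.\<close>
    fix X :: "nat \<Rightarrow> real" assume X: "\<forall>i. X i \<in> UNIV - {0}" "X \<longlonglongrightarrow> 0"
    let ?q = "\<lambda>i z. v z * ((\<psi> (z - (t + X i) *\<^sub>R w) - \<psi> (z - t *\<^sub>R w)) / X i)"
    have eq: "(?H (t + X i) - ?H t) / X i = (LINT z|lebesgue_on U. ?q i z)" for i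
      by (simp add: int right_diff_distrib flip: Bochner_Integration.integral_diff)
    have lim: "(\<lambda>i. ?q i z) \<longlonglongrightarrow> v z * - frechet_derivative \<psi> (at (z - t *\<^sub>R w)) w" for z
    proof (intro tendsto_mult tendsto_const)
      have "((\<lambda>h. (\<psi> (z - (t + h) *\<^sub>R w) - \<psi> (z - t *\<^sub>R w)) / h) \<longlongrightarrow>
          - frechet_derivative \<psi> (at (z - t *\<^sub>R w)) w) (at 0)"
        using deriv[of z] unfolding DERIV_def .
      then show "(\<lambda>i. (\<psi> (z - (t + X i) *\<^sub>R w) - \<psi> (z - t *\<^sub>R w)) / X i) \<longlonglongrightarrow>
          - frechet_derivative \<psi> (at (z - t *\<^sub>R w)) w"
        using X unfolding tendsto_at_iff_sequentially by (auto simp: o_def)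
    qed
    have "(\<lambda>i. LINT z|lebesgue_on U. ?q i z) \<longlonglongrightarrow>
        (LINT z|lebesgue_on U. v z * - frechet_derivative \<psi> (at (z - t *\<^sub>R w)) w)"
    proof (rule integral_dominated_convergence[where w = "\<lambda>z. B * (C * norm w)"])
      have q_meas: "?q i \<in> borel_measurable (lebesgue_on U)" for i
        using borel_measurable_integrable[OF int[of "(t + X i) *\<^sub>R w"]]
          borel_measurable_integrable[OF int[of "t *\<^sub>R w"]]
        by (simp add: right_diff_distrib)
      show "?q i \<in> borel_measurable (lebesgue_on U)" for i by (rule q_meas)
      show "(\<lambda>z. v z * - frechet_derivative \<psi> (at (z - t *\<^sub>R w)) w) \<in> borel_measurable (lebesgue_on U)"
        by (rule borel_measurable_LIMSEQ_metric[OF q_meas]) (rule lim)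
      show "integrable (lebesgue_on U) (\<lambda>z. B * (C * norm w))"
        by (rule integrable_bounded_continuous[OF U, where B = "\<bar>B * (C * norm w)\<bar>"]) auto
      show "AE z in lebesgue_on U. (\<lambda>i. ?q i z) \<longlonglongrightarrow> v z * - frechet_derivative \<psi> (at (z - t *\<^sub>R w)) w"
        by (intro AE_I2 lim)
      show "AE z in lebesgue_on U. norm (?q i z) \<le> B * (C * norm w)" for i
      proof (rule AE_I2)
        fix z assume "z \<in> space (lebesgue_on U)"
        then have "\<bar>v z\<bar> \<le> B" using v(2) by simp
        moreover have "\<bar>(\<psi> (z - (t + X i) *\<^sub>R w) - \<psi> (z - t *\<^sub>R w)) / X i\<bar> \<le> C * norm w"
        proof -
          have "(z - (t + X i) *\<^sub>R w) - (z - t *\<^sub>R w) = - (X i *\<^sub>R w)" by (simp add: algebra_simps)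
          then have "\<bar>\<psi> (z - (t + X i) *\<^sub>R w) - \<psi> (z - t *\<^sub>R w)\<bar> \<le> C * norm w * \<bar>X i\<bar>"
            using C[of "z - (t + X i) *\<^sub>R w" "z - t *\<^sub>R w"] by (simp add: mult_ac)
          then show ?thesis using X(1) by (simp add: pos_divide_le_eq)
        qed
        ultimately show "norm (?q i z) \<le> B * (C * norm w)"
          unfolding real_norm_def abs_mult by (intro mult_mono) auto
      qed
    qed
    then show "((\<lambda>h. (?H (t + h) - ?H t) / h) \<circ> X) \<longlonglongrightarrow> ?D"
      by (simp add: o_def eq)
  qed
  then show ?thesis unfolding DERIV_def .
qed

text \<open>Discrete integration by parts: the increment moves from the test function to
  \<open>v\<close>.\<close>

lemma integral_increment_test:
  fixes v \<psi> :: "'a::euclidean_space \<Rightarrow> real"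
  assumes U: "open U" and v: "continuous_on U v" and \<psi>: "\<psi> \<in> test_functions U"
    and shift: "\<And>z. z \<in> closure {x. \<psi> x \<noteq> 0} \<Longrightarrow> z + w \<in> U"
  shows "integrable (lebesgue_on U) (\<lambda>z. (v (z + w) - v z) * \<psi> z)"
    and "(LINT z|lebesgue_on U. v z * \<psi> (z - w)) - (LINT z|lebesgue_on U. v z * \<psi> z)
      = (LINT z|lebesgue_on U. (v (z + w) - v z) * \<psi> z)"
proof -
  note \<psi>' = test_functionsD[OF \<psi>]
  \<comment> \<open>On \<open>W\<close> both \<open>v z\<close> and \<open>v (z + w)\<close> are
    evaluated inside \<open>U\<close>, where \<open>v\<close> is continuous; the closed support of
    \<open>\<psi>\<close> lies in \<open>W\<close>.\<close>
  define W where "W = U \<inter> (\<lambda>z. z + w) -` U"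
  have W: "open W" unfolding W_def
    by (intro open_Int U open_vimage continuous_intros)
  have \<psi>W: "\<psi> \<in> test_functions W"
    using \<psi> shift \<psi>'(3) by (auto simp: test_functions_def W_def)
  have "continuous_on W (\<lambda>z. v (z + w))"
    by (rule continuous_on_compose2[OF v]) (auto simp: W_def intro!: continuous_intros)
  then have "integrable (lebesgue_on W) (\<lambda>z. v (z + w) * \<psi> z)"
    by (intro integrable_mult_test_function[OF W _ \<psi>W] locally_integrable_continuous)
  moreover have "(\<lambda>z. indicator W z *\<^sub>R (v (z + w) * \<psi> z)) = (\<lambda>z. indicator U z *\<^sub>R (v (z + w) * \<psi> z))"
    using test_functionsD(5)[OF \<psi>W] by (auto simp: fun_eq_iff indicator_def W_def)
  ultimately have i1: "integrable (lebesgue_on U) (\<lambda>z. v (z + w) * \<psi> z)"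
    unfolding integrable_lebesgue_on_iff[OF U] integrable_lebesgue_on_iff[OF W] by (simp only:)
  have i2: "integrable (lebesgue_on U) (\<lambda>z. v z * \<psi> z)"
    by (intro integrable_mult_test_function[OF U _ \<psi>] locally_integrable_continuous v)
  show "integrable (lebesgue_on U) (\<lambda>z. (v (z + w) - v z) * \<psi> z)"
    using i1 i2 by (simp add: left_diff_distrib)
  have "(LINT z|lebesgue_on U. v z * \<psi> (z - w)) = (LINT z|lebesgue_on U. v (z + w) * \<psi> z)"
    by (rule integral_shift_test[OF U v smooth_continuous[OF \<psi>'(1)]])
      (use \<psi>'(4,5) shift in blast)
  then show "(LINT z|lebesgue_on U. v z * \<psi> (z - w)) - (LINT z|lebesgue_on U. v z * \<psi> z)
      = (LINT z|lebesgue_on U. (v (z + w) - v z) * \<psi> z)"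
    using i1 i2 by (simp add: left_diff_distrib)
qed

section \<open>Gradient bounds versus Lipschitz bounds\<close>

text \<open>The derivative of \<open>?H\<close> at \<open>t\<close> is the integral of
  \<open>g z \<bullet> w\<close> against the translate of \<open>\<psi>\<close>, hence at most
  \<open>L * norm w\<close> times the integral of \<open>\<psi>\<close>. The mean value theorem on
  [0, 1] gives the estimate averaged over a ball around \<open>x\<close>; continuity makes it
  pointwise.\<close>

lemma weak_gradient_bound_imp_increment_le:
  fixes v :: "'a::euclidean_space \<Rightarrow> real"
  assumes U: "open U" "bounded U" and v: "continuous_on U v" "\<And>x. x \<in> U \<Longrightarrow> \<bar>v x\<bar> \<le> B"
    and g: "has_weak_gradient U v g" "AE x in lebesgue_on U. norm (g x) \<le> L"
    and seg: "closed_segment x y \<subseteq> U"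
  shows "v y - v x \<le> L * norm (y - x)"
proof -
  define w where "w = y - x"
  \<comment> \<open>One radius serves the whole segment, so test functions supported in
    \<open>ball x e\<close> stay inside \<open>U\<close> while they are carried along
    \<open>w\<close>.\<close>
  obtain e where e: "e > 0" "(\<Union>z\<in>closed_segment x y. cball z e) \<subseteq> U"
    using compact_subset_open_imp_cball_epsilon_subset[OF compact_segment U(1) seg] by blast
  have near: "z + t *\<^sub>R w \<in> U" if "z \<in> ball x e" "0 \<le> t" "t \<le> 1" for z t
  proof -
    have "x + t *\<^sub>R w \<in> closed_segment x y"
      using that unfolding closed_segment_def w_def
      by (auto intro!: exI[of _ t] simp: algebra_simps)
    moreover have "z + t *\<^sub>R w \<in> cball (x + t *\<^sub>R w) e" using that by (simp add: dist_norm)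
    ultimately show ?thesis using e(2) by blast
  qed
  define f where "f z = L * norm w - (v (z + w) - v z)" for z
  have f_cont: "continuous_on (ball x e) f" unfolding f_def
    using near[of _ 0] near[of _ 1]
    by (intro continuous_intros continuous_on_compose2[OF v(1)]) auto
  have "AE z in lebesgue_on (ball x e). 0 \<le> f z"
  proof (rule AE_nonneg_if_test_integrals_nonneg)
    show "locally_integrable (ball x e) f" by (rule locally_integrable_continuous[OF f_cont])
    fix \<psi> assume \<psi>: "\<psi> \<in> test_functions (ball x e)" and nonneg: "\<And>x. 0 \<le> \<psi> x"
    note \<psi>' = test_functionsD[OF \<psi>]
    have supp: "z + t *\<^sub>R w \<in> U" if "z \<in> closure {x. \<psi> x \<noteq> 0}" "0 \<le> t" "t \<le> 1" for z t
      using that \<psi>'(3) near by blast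
    have \<psi>U: "\<psi> \<in> test_functions U"
      using test_functions_translate[OF \<psi>, of 0 U] supp[of _ 0] by simp
    let ?H = "\<lambda>t. LINT z|lebesgue_on U. v z * \<psi> (z - t *\<^sub>R w)"
    let ?D = "\<lambda>t. - (LINT z|lebesgue_on U. v z * frechet_derivative \<psi> (at (z - t *\<^sub>R w)) w)"
    have D_le: "?D t \<le> L * norm w * (LINT z|lebesgue_on U. \<psi> z)" if t: "0 \<le> t" "t \<le> 1" for t
    proof -
      let ?\<psi> = "\<lambda>z. \<psi> (z - t *\<^sub>R w)"
      have test: "?\<psi> \<in> test_functions U"
        by (rule test_functions_translate[OF \<psi>]) (rule supp[OF _ t])
      have "?D t = (LINT z|lebesgue_on U. (g z \<bullet> w) * ?\<psi> z)"
        using has_weak_gradient_directional[OF U(1) g(1) test, of w]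
        by (simp add: frechet_derivative_translate[OF \<psi>'(1)])
      also have "\<dots> \<le> (LINT z|lebesgue_on U. (L * norm w) * ?\<psi> z)"
      proof (rule integral_mono_AE)
        show "integrable (lebesgue_on U) (\<lambda>z. (g z \<bullet> w) * ?\<psi> z)"
          using g(1) unfolding has_weak_gradient_def
          by (intro integrable_mult_test_function[OF U(1) _ test] locally_integrable_inner) auto
        show "integrable (lebesgue_on U) (\<lambda>z. (L * norm w) * ?\<psi> z)"
          by (intro integrable_mult_test_function[OF U(1) _ test] locally_integrable_continuous) auto
        show "AE z in lebesgue_on U. (g z \<bullet> w) * ?\<psi> z \<le> (L * norm w) * ?\<psi> z"
          using g(2)
        proof eventually_elim
          case (elim z)
          have "g z \<bullet> w \<le> norm (g z) * norm w" by (rule norm_cauchy_schwarz)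
          also have "\<dots> \<le> L * norm w" using elim by (intro mult_right_mono) auto
          finally show ?case by (intro mult_right_mono nonneg)
        qed
      qed
      also have "\<dots> = L * norm w * (LINT z|lebesgue_on U. 1 * \<psi> (z - t *\<^sub>R w))" by simp
      \<comment> \<open>The increments of the constant function 1 vanish, so translation preserves
        the integral of \<open>\<psi>\<close>.\<close>
      also have "(LINT z|lebesgue_on U. 1 * \<psi> (z - t *\<^sub>R w)) = (LINT z|lebesgue_on U. 1 * \<psi> z)"
        using integral_increment_test(2)[OF U(1) _ \<psi>U supp[OF _ t], of "\<lambda>z. 1"] by simp
      finally show ?thesis by simp
    qed
    obtain t where t: "0 < t" "t < 1" "?H 1 - ?H 0 = (1 - 0) * ?D t"
      using MVT2[of 0 1 ?H ?D] integral_translate_test_has_derivative[OF U v \<psi>] by auto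
    have H: "?H 1 - ?H 0 = (LINT z|lebesgue_on U. (v (z + w) - v z) * \<psi> z)"
      using integral_increment_test(2)[OF U(1) v(1) \<psi>U, of w] supp[of _ 1] by simp
    have int: "integrable (lebesgue_on U) (\<lambda>z. (v (z + w) - v z) * \<psi> z)"
      using integral_increment_test(1)[OF U(1) v(1) \<psi>U, of w] supp[of _ 1] by simp
    have int1: "integrable (lebesgue_on U) (\<lambda>z. (L * norm w) * \<psi> z)"
      by (intro integrable_mult_test_function[OF U(1) _ \<psi>U] locally_integrable_continuous) auto
    have "(LINT z|lebesgue_on (ball x e). f z * \<psi> z) = (LINT z|lebesgue_on U. f z * \<psi> z)"
      using \<psi>'(5) test_functionsD(5)[OF \<psi>U] U(1)
      by (intro integral_lebesgue_on_support) auto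
    also have "\<dots> = (LINT z|lebesgue_on U. (L * norm w) * \<psi> z - (v (z + w) - v z) * \<psi> z)"
      by (simp add: f_def left_diff_distrib)
    also have "\<dots> = L * norm w * (LINT z|lebesgue_on U. \<psi> z) - (?H 1 - ?H 0)"
      using int int1 unfolding H by (subst Bochner_Integration.integral_diff) auto
    also have "\<dots> \<ge> 0" using D_le[of t] t by simp
    finally show "0 \<le> (LINT z|lebesgue_on (ball x e). f z * \<psi> z)" .
  qed auto
  then have "0 \<le> f x"
    by (rule AE_open_imp_all[OF open_ball f_cont]) (use e in auto)
  then show ?thesis by (simp add: f_def w_def)
qed

lemma weak_gradient_bound_imp_lipschitz:
  fixes v :: "'a::euclidean_space \<Rightarrow> real"
  assumes "open U" "bounded U" "continuous_on U v" "\<And>x. x \<in> U \<Longrightarrow> \<bar>v x\<bar> \<le> B"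
    and "has_weak_gradient U v g" "AE x in lebesgue_on U. norm (g x) \<le> L"
    and "closed_segment x y \<subseteq> U"
  shows "\<bar>v y - v x\<bar> \<le> L * norm (y - x)"
  using weak_gradient_bound_imp_increment_le[OF assms]
    weak_gradient_bound_imp_increment_le[OF assms(1-6), of y x] assms(7)
  by (simp add: closed_segment_commute norm_minus_commute)

text \<open>The derivative of \<open>?H\<close> at 0 is the integral of
  \<open>g z \<bullet> w\<close> against \<open>\<psi>\<close>, and the Lipschitz bound limits its
  right difference quotients. This yields \<open>g x \<bullet> w \<le> L * norm w\<close> almost
  everywhere for each \<open>w\<close>; taking \<open>w = g x\<close> then bounds the norm.
  \<open>g\<close> is an arbitrary weak gradient of \<open>v\<close>.\<close>

lemma lipschitz_imp_weak_gradient_bound: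
  fixes v :: "'a::euclidean_space \<Rightarrow> real"
  assumes U: "open U" "bounded U" and v: "continuous_on U v" "\<And>x. x \<in> U \<Longrightarrow> \<bar>v x\<bar> \<le> B"
    and g: "has_weak_gradient U v g"
    and lip: "\<And>x y. closed_segment x y \<subseteq> U \<Longrightarrow> \<bar>v y - v x\<bar> \<le> L * norm (y - x)"
  shows "AE x in lebesgue_on U. norm (g x) \<le> L"
proof -
  have lg: "locally_integrable U g" using g by (simp add: has_weak_gradient_def)
  have dir: "AE x in lebesgue_on U. 0 \<le> L * norm w - g x \<bullet> w" for w
  proof (rule AE_nonneg_if_test_integrals_nonneg[OF U(1)])
    show "locally_integrable U (\<lambda>x. L * norm w - g x \<bullet> w)"
      by (intro locally_integrable_diff locally_integrable_inner[OF lg] locally_integrable_continuous) auto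
    fix \<psi> assume \<psi>: "\<psi> \<in> test_functions U" and nonneg: "\<And>x. 0 \<le> \<psi> x"
    note \<psi>' = test_functionsD[OF \<psi>]
    let ?H = "\<lambda>t. LINT z|lebesgue_on U. v z * \<psi> (z - t *\<^sub>R w)"
    define I where "I = L * norm w * (LINT z|lebesgue_on U. \<psi> z)"
    obtain e where e: "e > 0" "(\<Union>z\<in>closure {x. \<psi> x \<noteq> 0}. cball z e) \<subseteq> U"
      using compact_subset_open_imp_cball_epsilon_subset[OF \<psi>'(2) U(1) \<psi>'(3)] by blast
    have int1: "integrable (lebesgue_on U) (\<lambda>z. c * \<psi> z)" for c
      by (intro integrable_mult_test_function[OF U(1) _ \<psi>] locally_integrable_continuous) auto
    \<comment> \<open>For such \<open>t\<close> the segment from a support point \<open>z\<close> to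
      \<open>z + t *\<^sub>R w\<close> stays in \<open>U\<close>; adding 1 to the norm covers
      \<open>w = 0\<close>.\<close>
    have quotient: "(?H (0 + t) - ?H 0) / t \<le> I" if t: "0 < t" "t < e / (norm w + 1)" for t
    proof -
      have "t * norm w \<le> t * (norm w + 1)" using t by simp
      also have "\<dots> \<le> e" using t by (simp add: pos_less_divide_eq add_nonneg_pos)
      finally have tw: "t * norm w \<le> e" .
      have seg: "closed_segment z (z + t *\<^sub>R w) \<subseteq> U" if "z \<in> closure {x. \<psi> x \<noteq> 0}" for z
      proof -
        have "closed_segment z (z + t *\<^sub>R w) \<subseteq> cball z e"
          using e(1) tw t by (intro closed_segment_subset convex_cball) (auto simp: dist_norm)
        then show ?thesis using e(2) that by blast
      qed
      then have shift: "z + t *\<^sub>R w \<in> U" if "z \<in> closure {x. \<psi> x \<noteq> 0}" for z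
        using that by auto
      have "?H t - ?H 0 = (LINT z|lebesgue_on U. (v (z + t *\<^sub>R w) - v z) * \<psi> z)"
        using integral_increment_test(2)[OF U(1) v(1) \<psi> shift] by simp
      also have "\<dots> \<le> (LINT z|lebesgue_on U. (L * (t * norm w)) * \<psi> z)"
      proof (rule integral_mono[OF integral_increment_test(1)[OF U(1) v(1) \<psi> shift] int1])
        fix z
        show "(v (z + t *\<^sub>R w) - v z) * \<psi> z \<le> (L * (t * norm w)) * \<psi> z"
        proof (cases "\<psi> z = 0")
          case False
          then have "\<bar>v (z + t *\<^sub>R w) - v z\<bar> \<le> L * (t * norm w)"
            using lip[OF seg[OF \<psi>'(4)]] t by fastforce
          then show ?thesis by (intro mult_right_mono nonneg) auto
        qed simp
      qed
      also have "\<dots> = t * I" by (simp add: I_def)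
      finally show ?thesis using t by (simp add: pos_divide_le_eq mult.commute)
    qed
    have "((\<lambda>h. (?H (0 + h) - ?H 0) / h) \<longlongrightarrow>
        - (LINT z|lebesgue_on U. v z * frechet_derivative \<psi> (at (z - 0 *\<^sub>R w)) w)) (at 0)"
      using integral_translate_test_has_derivative[OF U v \<psi>, of w 0]
      unfolding DERIV_def by blast
    then have "((\<lambda>h. (?H (0 + h) - ?H 0) / h) \<longlongrightarrow> (LINT z|lebesgue_on U. (g z \<bullet> w) * \<psi> z)) (at_right 0)"
      using has_weak_gradient_directional[OF U(1) g \<psi>, of w]
      by (simp add: filterlim_at_split)
    moreover have "0 < e / (norm w + 1)" using e by (simp add: add_nonneg_pos)
    then have "\<forall>\<^sub>F h in at_right 0. (?H (0 + h) - ?H 0) / h \<le> I"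
      unfolding eventually_at_right_field using quotient by blast
    ultimately have "(LINT z|lebesgue_on U. (g z \<bullet> w) * \<psi> z) \<le> I"
      by (rule tendsto_upperbound) simp
    moreover have "integrable (lebesgue_on U) (\<lambda>z. (g z \<bullet> w) * \<psi> z)"
      by (rule integrable_mult_test_function[OF U(1) locally_integrable_inner[OF lg] \<psi>])
    ultimately show "0 \<le> (LINT z|lebesgue_on U. (L * norm w - g z \<bullet> w) * \<psi> z)"
      using int1[of "L * norm w"] by (simp add: left_diff_distrib I_def)
  qed
  \<comment> \<open>The exceptional null set depends on \<open>w\<close>. Countably many directions
    share one null set, and density with continuity in \<open>w\<close> recovers all of them,
    including the \<open>x\<close>-dependent choice \<open>w = g x\<close>.\<close>
  obtain D :: "'a set" where D: "countable D" "\<And>X. open X \<Longrightarrow> X \<noteq> {} \<Longrightarrow> \<exists>d\<in>D. d \<in> X"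
    using countable_dense_setE by blast
  have "AE x in lebesgue_on U. \<forall>w\<in>D. 0 \<le> L * norm w - g x \<bullet> w"
    using dir D(1) by (simp add: AE_ball_countable)
  then show ?thesis
  proof eventually_elim
    case (elim x)
    have all: "0 \<le> L * norm w - g x \<bullet> w" for w
    proof (rule ccontr)
      assume "\<not> 0 \<le> L * norm w - g x \<bullet> w"
      then have "w \<in> {w. L * norm w - g x \<bullet> w < 0}" by simp
      then have "{w. L * norm w - g x \<bullet> w < 0} \<noteq> {}" by blast
      moreover have "open {w. L * norm w - g x \<bullet> w < 0}"
        by (intro open_Collect_less continuous_intros)
      ultimately obtain d where "d \<in> D" "L * norm d - g x \<bullet> d < 0" using D(2) by blast
      with elim show False by force
    qed
    obtain b :: 'a where "b \<in> Basis" using nonempty_Basis by blast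
    \<comment> \<open>Adding the inequalities for \<open>b\<close> and \<open>- b\<close> cancels
      the inner products; this settles the case \<open>g x = 0\<close>.\<close>
    then have "0 \<le> L" using all[of b] all[of "- b"] by simp
    show ?case
    proof (cases "g x = 0")
      case False
      then show ?thesis using all[of "g x"] by (simp add: dot_square_norm power2_eq_square)
    qed (use \<open>0 \<le> L\<close> in simp)
  qed
qed

section \<open>The distance function\<close>

text \<open>Square \<open>infdist x A \<le> norm (x - a)\<close> and expand: the term quadratic in
  \<open>x\<close> cancels and an affine minorant remains.\<close>

lemma norm_power2_minus_infdist_power2_ge:
  fixes x :: "'a::euclidean_space"
  assumes "a \<in> A"
  shows "2 * (x \<bullet> a) - a \<bullet> a \<le> (norm x)\<^sup>2 - (infdist x A)\<^sup>2"
proof -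
  have "(infdist x A)\<^sup>2 \<le> (norm (x - a))\<^sup>2"
    using infdist_le[OF assms, of x] by (intro power_mono) (auto simp: dist_norm infdist_nonneg)
  then show ?thesis by (simp add: power2_norm_eq_inner algebra_simps inner_commute)
qed

text \<open>The function is the supremum over \<open>a \<in> A\<close> of the affine functions \<open>2 (x \<bullet> a) - a \<bullet> a\<close>.\<close>

lemma convex_on_norm_power2_minus_infdist_power2:
  fixes A :: "'a::euclidean_space set"
  assumes A: "closed A" "A \<noteq> {}"
  shows "convex_on UNIV (\<lambda>x. (norm x)\<^sup>2 - (infdist x A)\<^sup>2)"
proof (rule convex_onI)
  fix t :: real and x y :: 'a
  assume t: "0 < t" "t < 1"
  let ?F = "\<lambda>x. (norm x)\<^sup>2 - (infdist x A)\<^sup>2"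
  let ?z = "(1 - t) *\<^sub>R x + t *\<^sub>R y"
  \<comment> \<open>The affine minorant of a point nearest to \<open>?z\<close> touches the function
    at \<open>?z\<close>, and it lies below the function at \<open>x\<close> and
    \<open>y\<close>.\<close>
  obtain a where a: "a \<in> A" "infdist ?z A = dist ?z a"
    using infdist_attains_inf[OF A, of ?z] by blast
  have "?F ?z = 2 * (?z \<bullet> a) - a \<bullet> a"
    unfolding a(2) dist_norm by (simp only: power2_norm_eq_inner) (simp add: algebra_simps inner_commute)
  also have "\<dots> = (1 - t) * (2 * (x \<bullet> a) - a \<bullet> a) + t * (2 * (y \<bullet> a) - a \<bullet> a)"
    by (simp add: algebra_simps)
  also have "\<dots> \<le> (1 - t) * ?F x + t * ?F y"
    using t by (intro add_mono mult_left_mono norm_power2_minus_infdist_power2_ge[OF a(1)]) auto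
  finally show "?F ?z \<le> (1 - t) * ?F x + t * ?F y" .
qed simp

text \<open>Convexity makes the quotients monotone in the step and bounds them below by the backward
  slope \<open>F x - F (x - b)\<close>, so they decrease to a limit as the step shrinks.\<close>

lemma convex_on_right_quotients_convergent:
  fixes F :: "'a::real_vector \<Rightarrow> real"
  assumes F: "convex_on UNIV F"
  shows "convergent (\<lambda>n. (F (x + inverse (real (Suc n)) *\<^sub>R b) - F x) / inverse (real (Suc n)))"
proof -
  let ?q = "\<lambda>s. (F (x + s *\<^sub>R b) - F x) / s"
  have conv: "F ((1 - t) *\<^sub>R y + t *\<^sub>R z) \<le> (1 - t) * F y + t * F z" if "0 \<le> t" "t \<le> 1" for t y z
    using convex_onD[OF F] that by simp
  have mono: "?q s \<le> ?q t" if "0 < s" "s \<le> t" for s t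
  proof -
    have "x + s *\<^sub>R b = (1 - s / t) *\<^sub>R x + (s / t) *\<^sub>R (x + t *\<^sub>R b)"
      using that by (simp add: algebra_simps)
    then have "F (x + s *\<^sub>R b) \<le> (1 - s / t) * F x + (s / t) * F (x + t *\<^sub>R b)"
      using conv[of "s / t" x "x + t *\<^sub>R b"] that by simp
    then have "F (x + s *\<^sub>R b) - F x \<le> s * ?q t"
      using that by (simp add: field_simps)
    then show ?thesis using that by (simp add: pos_divide_le_eq mult.commute)
  qed
  have bound: "F x - F (x - b) \<le> ?q s" if "0 < s" for s
  proof -
    \<comment> \<open>\<open>x\<close> is the convex combination of \<open>x + s *\<^sub>R b\<close>
      and \<open>x - b\<close> with weights 1/(1+s) and s/(1+s).\<close>
    have eq: "1 - s / (1 + s) = 1 / (1 + s)" using that by (simp add: field_simps)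
    have "(1 + s) *\<^sub>R x = (x + s *\<^sub>R b) + s *\<^sub>R (x - b)" by (simp add: algebra_simps)
    then have "x = (1 / (1 + s)) *\<^sub>R ((x + s *\<^sub>R b) + s *\<^sub>R (x - b))"
      using that by (metis add_pos_pos divide_self_if less_irrefl mult.commute scaleR_one scaleR_scaleR
          times_divide_eq_left zero_less_one mult_1)
    then have "x = (1 - s / (1 + s)) *\<^sub>R (x + s *\<^sub>R b) + (s / (1 + s)) *\<^sub>R (x - b)"
      unfolding eq by (simp add: scaleR_add_right)
    then have "F x \<le> (1 / (1 + s)) * F (x + s *\<^sub>R b) + (s / (1 + s)) * F (x - b)"
      using conv[of "s / (1 + s)" "x + s *\<^sub>R b" "x - b"] that unfolding eq by simp
    also have "\<dots> = (F (x + s *\<^sub>R b) + s * F (x - b)) / (1 + s)"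
      by (simp add: add_divide_distrib)
    finally have "(1 + s) * F x \<le> F (x + s *\<^sub>R b) + s * F (x - b)"
      using that by (simp add: pos_le_divide_eq mult.commute)
    then have "s * (F x - F (x - b)) \<le> F (x + s *\<^sub>R b) - F x"
      by (simp add: algebra_simps)
    then show ?thesis using that by (simp add: pos_le_divide_eq mult.commute)
  qed
  have "decseq (\<lambda>n. ?q (inverse (real (Suc n))))"
    unfolding decseq_def by (intro allI impI mono) (auto intro!: le_imp_inverse_le)
  moreover have "\<forall>n. F x - F (x - b) \<le> ?q (inverse (real (Suc n)))"
    by (intro allI bound) simp
  ultimately obtain L where "(\<lambda>n. ?q (inverse (real (Suc n)))) \<longlonglongrightarrow> L"
    by (rule decseq_convergent)
  then show ?thesis by (auto simp: convergent_def)
qed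

text \<open>The quotients of the squared distance converge, being those of the squared norm minus
  those of a convex function. Dividing by the sum of the two distances, whose limit
  \<open>2 * infdist x A\<close> is positive off \<open>A\<close>, removes the square.\<close>

lemma infdist_right_quotients_convergent:
  fixes A :: "'a::euclidean_space set"
  assumes A: "closed A" "A \<noteq> {}" and x: "x \<notin> A"
  shows "convergent (\<lambda>n. (infdist (x + inverse (real (Suc n)) *\<^sub>R b) A - infdist x A) / inverse (real (Suc n)))"
proof -
  define s where "s n = inverse (real (Suc n))" for n
  have s: "s \<longlonglongrightarrow> 0" "\<And>n. s n > 0"
    unfolding s_def[abs_def] using LIMSEQ_inverse_real_of_nat by auto
  let ?d = "\<lambda>x. infdist x A"
  let ?F = "\<lambda>x. (norm x)\<^sup>2 - (?d x)\<^sup>2"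
  have pos: "0 < ?d x"
    using A x by (metis in_closed_iff_infdist_zero infdist_nonneg order_less_le)
  obtain L where L: "(\<lambda>n. (?F (x + s n *\<^sub>R b) - ?F x) / s n) \<longlonglongrightarrow> L"
    using convex_on_right_quotients_convergent[OF convex_on_norm_power2_minus_infdist_power2[OF A], of x b]
    unfolding s_def convergent_def by blast
  have x_lim: "(\<lambda>n. x + s n *\<^sub>R b) \<longlonglongrightarrow> x + 0 *\<^sub>R b"
    by (intro tendsto_intros s)
  have "(\<lambda>n. ((2 * (x \<bullet> b) + s n * (b \<bullet> b)) - (?F (x + s n *\<^sub>R b) - ?F x) / s n) / (?d (x + s n *\<^sub>R b) + ?d x))
      \<longlonglongrightarrow> ((2 * (x \<bullet> b) + 0 * (b \<bullet> b)) - L) / (?d (x + 0 *\<^sub>R b) + ?d x)"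
    using pos by (intro tendsto_intros s L tendsto_infdist x_lim) auto
  moreover have "((2 * (x \<bullet> b) + s n * (b \<bullet> b)) - (?F (x + s n *\<^sub>R b) - ?F x) / s n) / (?d (x + s n *\<^sub>R b) + ?d x)
      = (?d (x + s n *\<^sub>R b) - ?d x) / s n" for n
  proof -
    have "(norm (x + s n *\<^sub>R b))\<^sup>2 - (norm x)\<^sup>2 = s n * (2 * (x \<bullet> b) + s n * (b \<bullet> b))"
      by (simp add: power2_norm_eq_inner algebra_simps inner_commute)
    then have "(2 * (x \<bullet> b) + s n * (b \<bullet> b)) - (?F (x + s n *\<^sub>R b) - ?F x) / s n
       = ((?d (x + s n *\<^sub>R b))\<^sup>2 - (?d x)\<^sup>2) / s n"
      using s(2)[of n] by (simp add: field_simps)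
    also have "\<dots> = (?d (x + s n *\<^sub>R b) - ?d x) / s n * (?d (x + s n *\<^sub>R b) + ?d x)"
      by (simp add: power2_eq_square algebra_simps diff_divide_distrib add_divide_distrib)
    finally show ?thesis
      using pos infdist_nonneg[of "x + s n *\<^sub>R b" A] by simp
  qed
  ultimately show ?thesis unfolding convergent_def s_def by auto
qed

section \<open>The weak gradient of the distance function\<close>

lemma continuous_on_closure_bounded:
  fixes v :: "'a::euclidean_space \<Rightarrow> real"
  assumes "bounded U" "continuous_on (closure U) v"
  obtains B where "\<And>x. x \<in> U \<Longrightarrow> \<bar>v x\<bar> \<le> B"
proof -
  have "compact (v ` closure U)"
    using assms by (intro compact_continuous_image) (auto simp: compact_closure)
  then obtain B where "\<forall>y\<in>v ` closure U. norm y \<le> B"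
    using compact_imp_bounded bounded_iff by blast
  then show ?thesis using closure_subset[of U] by (intro that[of B]) auto
qed

text \<open>The components of \<open>g\<close> are limits of right difference quotients along the
  basis. Tested against \<open>\<phi>\<close>, these quotients have two limits that must agree: a
  derivative of \<open>?H\<close> at 0, and the integral of \<open>g z \<bullet> b\<close> by
  dominated convergence. The dimension is a crude bound, improved to 1 later through the Lipschitz
  estimate.\<close>

lemma infdist_has_weak_gradient:
  fixes A U :: "'a::euclidean_space set"
  assumes U: "open U" "bounded U" and A: "closed A" "A \<noteq> {}" "A \<inter> U = {}"
  obtains g where "has_weak_gradient U (\<lambda>x. infdist x A) g" "g \<in> borel_measurable borel"
    "\<And>x. x \<in> U \<Longrightarrow> norm (g x) \<le> real DIM('a)"
proof -
  let ?d = "\<lambda>x. infdist x A"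
  define s where "s n = inverse (real (Suc n))" for n
  have s: "s \<longlonglongrightarrow> 0" "\<And>n. s n > 0"
    unfolding s_def[abs_def] using LIMSEQ_inverse_real_of_nat by auto
  define q where "q b n x = (?d (x + s n *\<^sub>R b) - ?d x) / s n" for b x n
  \<comment> \<open>Taking \<open>lim\<close> everywhere keeps \<open>G b\<close> Borel; its value
    is meaningful on \<open>U\<close>, where the quotients converge.\<close>
  define G where "G b x = lim (\<lambda>n. q b n x)" for b x
  define g where "g x = (\<Sum>b\<in>Basis. G b x *\<^sub>R b)" for x
  have q_cont: "continuous_on S (q b n)" for S b n
    unfolding q_def using s(2)[of n] by (intro continuous_intros) auto
  have q_meas [measurable]: "q b n \<in> borel_measurable borel" for b n
    by (rule borel_measurable_continuous_onI[OF q_cont])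
  have G_meas [measurable]: "G b \<in> borel_measurable borel" for b
    unfolding G_def[abs_def] by measurable
  have g_meas: "g \<in> borel_measurable borel" unfolding g_def[abs_def] by measurable
  have lim: "(\<lambda>n. q b n x) \<longlonglongrightarrow> G b x" if "x \<in> U" for b x
    using infdist_right_quotients_convergent[OF A(1,2), of x b] A(3) that
    unfolding G_def q_def s_def convergent_LIMSEQ_iff by blast
  have q_le: "\<bar>q b n x\<bar> \<le> 1" if "b \<in> Basis" for b n x
  proof -
    have "\<bar>?d (x + s n *\<^sub>R b) - ?d x\<bar> \<le> s n"
      using infdist_triangle_abs[of "x + s n *\<^sub>R b" A x] s(2)[of n] that by (simp add: dist_norm)
    then show ?thesis using s(2)[of n] by (simp add: q_def)
  qed
  have G_le: "\<bar>G b x\<bar> \<le> 1" if "b \<in> Basis" "x \<in> U" for b x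
    using tendsto_rabs[OF lim[OF that(2), of b]] q_le[OF that(1)] by (intro LIMSEQ_le_const2) auto
  have g_inner: "g x \<bullet> b = G b x" if "b \<in> Basis" for b x
    using that by (simp add: g_def inner_sum_left inner_Basis if_distrib sum.If_cases cong: if_cong)
  have g_le: "norm (g x) \<le> real DIM('a)" if "x \<in> U" for x
  proof -
    have "norm (g x) \<le> (\<Sum>b\<in>Basis. \<bar>g x \<bullet> b\<bar>)" by (rule norm_le_l1)
    also have "\<dots> \<le> (\<Sum>b\<in>(Basis :: 'a set). 1)" using G_le that by (intro sum_mono) (simp add: g_inner)
    finally show ?thesis by simp
  qed
  have d_cont: "continuous_on S ?d" for S by (intro continuous_intros)
  obtain B where B: "\<And>x. x \<in> U \<Longrightarrow> \<bar>?d x\<bar> \<le> B"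
    using continuous_on_closure_bounded[OF U(2) d_cont] by blast
  have "has_weak_gradient U ?d g"
    unfolding has_weak_gradient_def
  proof (intro conjI ballI)
    show "locally_integrable U ?d" by (rule locally_integrable_continuous[OF d_cont])
    show "locally_integrable U g"
      unfolding locally_integrable_def set_integrable_def
    proof (intro allI impI)
      fix K assume K: "compact K \<and> K \<subseteq> U"
      then show "integrable lebesgue (\<lambda>x. indicator K x *\<^sub>R g x)"
        using g_le g_meas emeasure_compact_finite[of K]
        by (intro integrableI_bounded_set_indicator[where B = "real DIM('a)"] AE_I2)
          (auto simp: compact_imp_closed measurable_completion)
    qed
    fix \<phi> :: "'a \<Rightarrow> real" and b :: 'a assume \<phi>: "\<phi> \<in> test_functions U" and b: "b \<in> Basis"
    note \<phi>' = test_functionsD[OF \<phi>]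
    let ?H = "\<lambda>t. LINT z|lebesgue_on U. ?d z * \<phi> (z - t *\<^sub>R b)"
    obtain e where e: "e > 0" "(\<Union>z\<in>closure {x. \<phi> x \<noteq> 0}. cball z e) \<subseteq> U"
      using compact_subset_open_imp_cball_epsilon_subset[OF \<phi>'(2) U(1) \<phi>'(3)] by blast
    \<comment> \<open>Once \<open>s n < e\<close>, shifting the support of \<open>\<phi>\<close>
      stays within \<open>U\<close>, so the increment identity applies.\<close>
    have "\<forall>\<^sub>F n in sequentially. s n < e" using s(1) e(1) by (rule order_tendstoD(2))
    then have ev: "\<forall>\<^sub>F n in sequentially. (?H (0 + s n) - ?H 0) / s n = (LINT z|lebesgue_on U. q b n z * \<phi> z)"
    proof eventually_elim
      case (elim n)
      have shift: "z + s n *\<^sub>R b \<in> U" if "z \<in> closure {x. \<phi> x \<noteq> 0}" for z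
      proof -
        have "z + s n *\<^sub>R b \<in> cball z e" using elim s(2)[of n] b by (simp add: dist_norm)
        then show ?thesis using e(2) that by blast
      qed
      have "(LINT z|lebesgue_on U. q b n z * \<phi> z)
          = (LINT z|lebesgue_on U. (?d (z + s n *\<^sub>R b) - ?d z) * \<phi> z / s n)"
        by (simp add: q_def)
      then show ?case
        using integral_increment_test(2)[OF U(1) d_cont \<phi> shift] by simp
    qed
    have "((\<lambda>h. (?H (0 + h) - ?H 0) / h) \<longlongrightarrow>
        - (LINT z|lebesgue_on U. ?d z * frechet_derivative \<phi> (at (z - 0 *\<^sub>R b)) b)) (at 0)"
      using integral_translate_test_has_derivative[OF U d_cont B \<phi>, of b 0]
      unfolding DERIV_def by blast
    moreover have "filterlim s (at 0) sequentially"
      unfolding filterlim_at using s by (intro conjI always_eventually allI) (auto simp: less_imp_neq[symmetric])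
    ultimately have "(\<lambda>n. (?H (0 + s n) - ?H 0) / s n) \<longlonglongrightarrow>
        - (LINT z|lebesgue_on U. ?d z * frechet_derivative \<phi> (at (z - 0 *\<^sub>R b)) b)"
      by (rule filterlim_compose)
    then have "(\<lambda>n. (?H (0 + s n) - ?H 0) / s n) \<longlonglongrightarrow>
        - (LINT z|lebesgue_on U. ?d z * frechet_derivative \<phi> (at z) b)"
      by (simp only: scaleR_zero_left diff_zero)
    then have lim1: "(\<lambda>n. LINT z|lebesgue_on U. q b n z * \<phi> z) \<longlonglongrightarrow>
        - (LINT z|lebesgue_on U. ?d z * frechet_derivative \<phi> (at z) b)"
      by (rule Lim_transform_eventually[OF _ ev])
    have lim2: "(\<lambda>n. LINT z|lebesgue_on U. q b n z * \<phi> z) \<longlonglongrightarrow> (LINT z|lebesgue_on U. (g z \<bullet> b) * \<phi> z)"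
    proof (rule integral_dominated_convergence[where w = "\<lambda>z. \<bar>1 * \<phi> z\<bar>"])
      show "integrable (lebesgue_on U) (\<lambda>z. \<bar>1 * \<phi> z\<bar>)"
        by (intro integrable_abs integrable_mult_test_function[OF U(1) _ \<phi>] locally_integrable_continuous) auto
      have \<phi>_meas: "\<phi> \<in> borel_measurable borel"
        by (rule borel_measurable_continuous_onI[OF smooth_continuous[OF \<phi>'(1)]])
      have restrict: "f \<in> borel_measurable (lebesgue_on U)" if "f \<in> borel_measurable borel" for f :: "'a \<Rightarrow> real"
        using that by (intro measurable_restrict_space1 measurable_completion) simp
      show "(\<lambda>z. (g z \<bullet> b) * \<phi> z) \<in> borel_measurable (lebesgue_on U)"
        using \<phi>_meas unfolding g_inner[OF b] by (intro restrict) measurable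
      show "(\<lambda>z. q b n z * \<phi> z) \<in> borel_measurable (lebesgue_on U)" for n
        using \<phi>_meas by (intro restrict) measurable
      show "AE z in lebesgue_on U. (\<lambda>n. q b n z * \<phi> z) \<longlonglongrightarrow> (g z \<bullet> b) * \<phi> z"
        unfolding g_inner[OF b] by (intro AE_I2 tendsto_intros lim) simp
      show "AE z in lebesgue_on U. norm (q b n z * \<phi> z) \<le> \<bar>1 * \<phi> z\<bar>" for n
        unfolding real_norm_def abs_mult using q_le[OF b] by (intro AE_I2 mult_right_mono) auto
    qed
    show "(LINT z|lebesgue_on U. ?d z * frechet_derivative \<phi> (at z) b) = - (LINT z|lebesgue_on U. (g z \<bullet> b) * \<phi> z)"
      using LIMSEQ_unique[OF lim1 lim2] by simp
  qed
  then show ?thesis using g_meas g_le by (rule that)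
qed

lemma infdist_frontier_in_W1_infty_0:
  fixes U :: "'a::euclidean_space set"
  assumes U: "open U" "bounded U" "U \<noteq> {}"
  shows "(\<lambda>x. infdist x (frontier U)) \<in> W1_infty_0 U"
proof -
  have "frontier U \<noteq> {}" "frontier U \<inter> U = {}"
    using U frontier_not_empty frontier_disjoint_eq not_bounded_UNIV by blast+
  then obtain g where g: "has_weak_gradient U (\<lambda>x. infdist x (frontier U)) g" "g \<in> borel_measurable borel"
    "\<And>x. x \<in> U \<Longrightarrow> norm (g x) \<le> real DIM('a)"
    using infdist_has_weak_gradient[OF U(1,2) frontier_closed] by blast
  have d_cont: "continuous_on S (\<lambda>x. infdist x (frontier U))" for S by (intro continuous_intros)
  obtain B where B: "\<And>x. x \<in> U \<Longrightarrow> \<bar>infdist x (frontier U)\<bar> \<le> B"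
    using continuous_on_closure_bounded[OF U(2) d_cont] by blast
  have "g \<in> borel_measurable (lebesgue_on U)"
    using g(2) by (intro measurable_restrict_space1 measurable_completion) simp
  then have "g \<in> Linfty U"
    unfolding Linfty_def using g(3) by (auto intro!: exI[of _ "real DIM('a)"] AE_I2)
  moreover have "(\<lambda>x. infdist x (frontier U)) \<in> Linfty U"
    unfolding Linfty_def using B U d_cont
    by (auto intro!: exI[of _ B] AE_I2 continuous_imp_measurable_on_sets_lebesgue)
  ultimately show ?thesis
    using g(1) d_cont by (auto simp: W1_infty_0_def W1_infty_def)
qed

section \<open>The functional \<open>J\<close> and its minimizers\<close>

text \<open>Covers the junk values too: \<open>J\<close> is 0 if the essential supremum is infinite.\<close>

lemma J_le:
  assumes "0 \<le> L" "AE x in lebesgue_on U. norm (weak_gradient U v x) \<le> L"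
  shows "J U v \<le> L"
proof (cases "(\<lambda>x. ereal (norm (weak_gradient U v x))) \<in> borel_measurable (lebesgue_on U)")
  case True
  then have "esssup (lebesgue_on U) (\<lambda>x. ereal (norm (weak_gradient U v x))) \<le> ereal L"
    using assms(2) by (intro esssup_I) auto
  then show ?thesis unfolding J_def
    using assms(1) by (cases "esssup (lebesgue_on U) (\<lambda>x. ereal (norm (weak_gradient U v x)))") auto
next
  case False
  then show ?thesis using assms(1) by (simp add: J_def esssup_non_measurable top_ereal_def)
qed

lemma AE_lebesgue_on_not_False:
  fixes U :: "'a::euclidean_space set"
  assumes "open U" "U \<noteq> {}"
  shows "\<not> (AE x in lebesgue_on U. False)"
proof
  assume "AE x in lebesgue_on U. False"
  then have "AE x in lebesgue_on U. 0 \<le> (- 1 :: real)" by simp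
  with AE_open_imp_all[OF assms(1), of "\<lambda>x. - 1"] assms(2) show False by auto
qed

text \<open>The bound \<open>L\<close> excludes an infinite essential supremum and the positive
  measure of \<open>U\<close> excludes a negative one, so \<open>real_of_ereal\<close> loses
  nothing.\<close>

lemma weak_gradient_le_J:
  fixes U :: "'a::euclidean_space set"
  assumes U: "open U" "U \<noteq> {}"
    and meas: "weak_gradient U v \<in> borel_measurable (lebesgue_on U)"
    and bound: "AE x in lebesgue_on U. norm (weak_gradient U v x) \<le> L"
  shows "AE x in lebesgue_on U. norm (weak_gradient U v x) \<le> J U v" "0 \<le> J U v"
proof -
  let ?e = "esssup (lebesgue_on U) (\<lambda>x. ereal (norm (weak_gradient U v x)))"
  have AE: "AE x in lebesgue_on U. ereal (norm (weak_gradient U v x)) \<le> ?e" by (rule esssup_AE)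
  have "?e \<le> ereal L" using meas bound by (intro esssup_I) auto
  moreover have "0 \<le> ?e"
  proof (rule ccontr)
    assume "\<not> 0 \<le> ?e"
    have "AE x in lebesgue_on U. False"
      using AE
    proof eventually_elim
      case (elim x)
      have "0 \<le> ereal (norm (weak_gradient U v x))" by simp
      with elim \<open>\<not> 0 \<le> ?e\<close> show False by (meson order_trans)
    qed
    then show False using AE_lebesgue_on_not_False[OF U] by blast
  qed
  ultimately obtain r where r: "?e = ereal r" "0 \<le> r" by (cases ?e) auto
  then have "J U v = r" by (simp add: J_def)
  with r AE show "AE x in lebesgue_on U. norm (weak_gradient U v x) \<le> J U v" "0 \<le> J U v" by auto
qed

lemma weak_gradient_works: "has_weak_gradient U v g \<Longrightarrow> has_weak_gradient U v (weak_gradient U v)"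
  unfolding weak_gradient_def by (rule someI[where P = "has_weak_gradient U v"])

text \<open>Membership provides some bounded weak gradient, whereas \<open>J\<close> refers to the
  chosen one. The bound travels from the first to a Lipschitz estimate and back to the second, so
  uniqueness of weak gradients is never invoked.\<close>

lemma W1_infty_0_lipschitz:
  fixes U :: "'a::euclidean_space set"
  assumes U: "open U" "bounded U" "U \<noteq> {}" and v: "v \<in> W1_infty_0 U"
  shows "0 \<le> J U v" "closed_segment x y \<subseteq> U \<Longrightarrow> \<bar>v y - v x\<bar> \<le> J U v * norm (y - x)"
proof -
  obtain g C where g: "has_weak_gradient U v g" and C: "AE x in lebesgue_on U. norm (g x) \<le> C"
    using v by (auto simp: W1_infty_0_def W1_infty_def Linfty_def)
  have cl: "continuous_on (closure U) v" using v by (simp add: W1_infty_0_def)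
  then have cont: "continuous_on U v" using closure_subset continuous_on_subset by blast
  obtain B where B: "\<And>x. x \<in> U \<Longrightarrow> \<bar>v x\<bar> \<le> B"
    using continuous_on_closure_bounded[OF U(2) cl] by blast
  note wg = weak_gradient_works[OF g]
  have "AE x in lebesgue_on U. norm (weak_gradient U v x) \<le> C"
    by (rule lipschitz_imp_weak_gradient_bound[OF U(1,2) cont B wg])
      (auto intro: weak_gradient_bound_imp_lipschitz[OF U(1,2) cont B g C])
  moreover have "weak_gradient U v \<in> borel_measurable (lebesgue_on U)"
    using wg by (intro locally_integrable_measurable U) (simp add: has_weak_gradient_def)
  ultimately have *: "AE x in lebesgue_on U. norm (weak_gradient U v x) \<le> J U v" "0 \<le> J U v"
    using weak_gradient_le_J[OF U(1,3)] by blast+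
  show "0 \<le> J U v" by (rule *)
  show "\<bar>v y - v x\<bar> \<le> J U v * norm (y - x)" if "closed_segment x y \<subseteq> U"
    by (rule weak_gradient_bound_imp_lipschitz[OF U(1,2) cont B wg *(1) that])
qed

lemma W1_infty_0_le_J_infdist:
  fixes U :: "'a::euclidean_space set"
  assumes U: "open U" "bounded U" and v: "v \<in> W1_infty_0 U" and x: "x \<in> U"
  shows "\<bar>v x\<bar> \<le> J U v * infdist x (frontier U)"
proof -
  have ne: "U \<noteq> {}" using x by blast
  have fr: "frontier U \<noteq> {}" "frontier U \<inter> U = {}"
    using U ne frontier_not_empty frontier_disjoint_eq not_bounded_UNIV by blast+
  let ?d = "infdist x (frontier U)"
  obtain y where y: "y \<in> frontier U" "?d = dist x y"
    using infdist_attains_inf[OF frontier_closed fr(1)] by blast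
  \<comment> \<open>A connected ball that meets both \<open>U\<close> and its complement would meet
    the frontier at distance less than \<open>?d\<close>.\<close>
  have ball: "ball x ?d \<subseteq> U"
  proof (rule ccontr)
    assume "\<not> ball x ?d \<subseteq> U"
    moreover have "x \<in> ball x ?d" using x y fr by auto
    ultimately have "ball x ?d \<inter> U \<noteq> {}" "ball x ?d - U \<noteq> {}"
      using x by blast+
    then have "ball x ?d \<inter> frontier U \<noteq> {}"
      by (intro connected_Int_frontier connected_ball)
    then obtain z where "dist x z < ?d" "z \<in> frontier U" by auto
    then show False using infdist_le[of z "frontier U" x] by simp
  qed
  have dpos: "0 < ?d" using x y fr by auto
  \<comment> \<open>The nearest boundary point \<open>y\<close> is not in \<open>U\<close>, so the
    Lipschitz bound is used on segments stopping short of it; \<open>v (z n)\<close> tends to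
    \<open>v y = 0\<close> by continuity on the closure.\<close>
  define z where "z n = x + (1 - inverse (real (Suc n))) *\<^sub>R (y - x)" for n
  have zball: "closed_segment x (z n) \<subseteq> U" and zdist: "norm (z n - x) \<le> ?d" for n
  proof -
    have "0 < inverse (real (Suc n))" "inverse (real (Suc n)) \<le> 1"
      by (auto simp: field_simps)
    then have *: "norm (z n - x) = (1 - inverse (real (Suc n))) * ?d"
      by (simp add: z_def y(2) dist_norm norm_minus_commute)
    also have "\<dots> < 1 * ?d" using dpos by (intro mult_strict_right_mono) auto
    finally have lt: "norm (z n - x) < ?d" by simp
    then show "norm (z n - x) \<le> ?d" by simp
    have "closed_segment x (z n) \<subseteq> ball x ?d"
      using lt dpos by (intro closed_segment_subset) (auto simp: dist_norm norm_minus_commute)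
    then show "closed_segment x (z n) \<subseteq> U" using ball by blast
  qed
  have "z \<longlonglongrightarrow> x + (1 - 0) *\<^sub>R (y - x)"
    unfolding z_def[abs_def] by (intro tendsto_intros LIMSEQ_inverse_real_of_nat)
  then have "z \<longlonglongrightarrow> y" by simp
  moreover have "z n \<in> closure U" for n
    using zball[of n] closure_subset[of U] by auto
  moreover have "y \<in> closure U" using y(1) by (simp add: frontier_def)
  moreover have "continuous_on (closure U) v" "v y = 0" using v y(1) by (auto simp: W1_infty_0_def)
  ultimately have "(\<lambda>n. v (z n)) \<longlonglongrightarrow> 0"
    using continuous_on_tendsto_compose[of "closure U" v z y sequentially] by simp
  then have "(\<lambda>n. \<bar>v (z n) - v x\<bar>) \<longlonglongrightarrow> \<bar>0 - v x\<bar>"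
    by (intro tendsto_intros)
  moreover have "\<bar>v (z n) - v x\<bar> \<le> J U v * ?d" for n
    using W1_infty_0_lipschitz(2)[OF U ne v zball[of n]]
      mult_left_mono[OF zdist[of n] W1_infty_0_lipschitz(1)[OF U ne v]] by linarith
  ultimately show ?thesis by (intro LIMSEQ_le_const2) auto
qed

text \<open>The distance function is 1-Lipschitz, which bounds every weak gradient of it, in
  particular the chosen one.\<close>

lemma J_infdist_frontier_le_1:
  fixes U :: "'a::euclidean_space set"
  assumes U: "open U" "bounded U" "U \<noteq> {}"
  shows "J U (\<lambda>x. infdist x (frontier U)) \<le> 1"
proof (rule J_le)
  let ?d = "\<lambda>x. infdist x (frontier U)"
  obtain g where "has_weak_gradient U ?d g"
    using infdist_frontier_in_W1_infty_0[OF U] by (auto simp: W1_infty_0_def W1_infty_def)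
  then have wg: "has_weak_gradient U ?d (weak_gradient U ?d)" by (rule weak_gradient_works)
  have d_cont: "continuous_on S ?d" for S by (intro continuous_intros)
  obtain B where B: "\<And>x. x \<in> U \<Longrightarrow> \<bar>?d x\<bar> \<le> B"
    using continuous_on_closure_bounded[OF U(2) d_cont] by blast
  show "AE x in lebesgue_on U. norm (weak_gradient U ?d x) \<le> 1"
  proof (rule lipschitz_imp_weak_gradient_bound[OF U(1,2) d_cont B wg])
    show "\<bar>?d y - ?d x\<bar> \<le> 1 * norm (y - x)" for x y
      using infdist_triangle_abs[of y "frontier U" x] by (simp add: dist_norm)
  qed
qed simp

section \<open>The equality case for minimizers\<close>

text \<open>The integral must be 0, so \<open>f\<close> vanishes almost everywhere; continuity,
  applied to \<open>- f\<close>, removes the exceptional set.\<close>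

lemma continuous_integral_le_0_imp_eq_0:
  fixes f :: "'a::euclidean_space \<Rightarrow> real"
  assumes U: "open U" and f: "continuous_on U f" "integrable (lebesgue_on U) f"
    "\<And>x. x \<in> U \<Longrightarrow> 0 \<le> f x" and le: "(LINT x|lebesgue_on U. f x) \<le> 0" and "x \<in> U"
  shows "f x = 0"
proof -
  have nonneg: "AE x in lebesgue_on U. 0 \<le> f x" using f(3) by (intro AE_I2) simp
  then have "(LINT x|lebesgue_on U. f x) = 0"
    using le integral_nonneg_AE[OF nonneg] by simp
  then have "AE x in lebesgue_on U. f x = 0"
    using integral_nonneg_eq_0_iff_AE[OF f(2) nonneg] by simp
  then have "AE x in lebesgue_on U. 0 \<le> - f x" by eventually_elim simp
  then have "0 \<le> - f x"
    using AE_open_imp_all[OF U continuous_on_minus[OF f(1)] _ \<open>x \<in> U\<close>] by blast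
  with f(3)[OF \<open>x \<in> U\<close>] show ?thesis by simp
qed

lemma abs_powr_continuous_integrable:
  fixes v :: "'a::euclidean_space \<Rightarrow> real"
  assumes U: "open U" "bounded U" and v: "continuous_on (closure U) v" and p: "0 < p"
  shows "continuous_on U (\<lambda>x. \<bar>v x\<bar> powr p)" "integrable (lebesgue_on U) (\<lambda>x. \<bar>v x\<bar> powr p)"
proof -
  have cont: "continuous_on (closure U) (\<lambda>x. \<bar>v x\<bar> powr p)"
    using p by (intro continuous_on_powr' continuous_intros v) auto
  then show cont': "continuous_on U (\<lambda>x. \<bar>v x\<bar> powr p)"
    using closure_subset continuous_on_subset by blast
  obtain B where "\<And>x. x \<in> U \<Longrightarrow> \<bar>\<bar>v x\<bar> powr p\<bar> \<le> B"
    using continuous_on_closure_bounded[OF U(2) cont] by blast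
  then show "integrable (lebesgue_on U) (\<lambda>x. \<bar>v x\<bar> powr p)"
    by (rule integrable_bounded_continuous[OF U cont'])
qed

lemma integral_abs_powr_pos:
  fixes v :: "'a::euclidean_space \<Rightarrow> real"
  assumes U: "open U" "bounded U" and v: "continuous_on (closure U) v" and p: "0 < p"
    and x: "x \<in> U" "v x \<noteq> 0"
  shows "0 < (LINT x|lebesgue_on U. \<bar>v x\<bar> powr p)"
proof (rule ccontr)
  assume "\<not> ?thesis"
  then have "\<bar>v x\<bar> powr p = 0"
    using x by (intro continuous_integral_le_0_imp_eq_0[OF U(1) abs_powr_continuous_integrable[OF U v p]]) auto
  then show False using x by simp
qed

theorem theorem2p1:
  fixes \<Omega> :: "(real ^ 'n) set" and p :: real and u :: "real ^ 'n \<Rightarrow> real"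
  assumes "open \<Omega>" and "connected \<Omega>" and "bounded \<Omega>"
    and "1 \<le> p"
    and "is_arg_min (\<lambda>v. J \<Omega> v / Lp_norm p \<Omega> v)
           (\<lambda>v. v \<in> W1_infty_0 \<Omega> \<and> (\<exists>x\<in>\<Omega>. v x \<noteq> 0)) u"
  shows "\<exists>c. \<forall>x\<in>\<Omega>. u x = c * infdist x (frontier \<Omega>)"
proof -
  define d where "d x = infdist x (frontier \<Omega>)" for x
  define M where "M = J \<Omega> u"
  define I where "I v = (LINT x|lebesgue_on \<Omega>. \<bar>v x\<bar> powr p)" for v :: "real ^ 'n \<Rightarrow> real"
  have p: "0 < p" using assms(4) by simp
  obtain x0 where x0: "x0 \<in> \<Omega>" "u x0 \<noteq> 0" and u: "u \<in> W1_infty_0 \<Omega>"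
    using assms(5) by (auto simp: is_arg_min_def)
  have ne: "\<Omega> \<noteq> {}" using x0 by blast
  have fr: "frontier \<Omega> \<noteq> {}" "frontier \<Omega> \<inter> \<Omega> = {}"
    using assms(1,3) ne frontier_not_empty frontier_disjoint_eq not_bounded_UNIV by blast+
  have d: "d \<in> W1_infty_0 \<Omega>" and Jd: "J \<Omega> d \<le> 1"
    unfolding d_def[abs_def]
    using infdist_frontier_in_W1_infty_0 J_infdist_frontier_le_1 assms(1,3) ne by blast+
  have d_pos: "0 < d x" if "x \<in> \<Omega>" for x
  proof -
    have "x \<notin> frontier \<Omega>" using that fr(2) by blast
    then show ?thesis unfolding d_def
      using fr(1) by (metis frontier_closed in_closed_iff_infdist_zero infdist_nonneg order_less_le)
  qed
  have cu: "continuous_on (closure \<Omega>) u" and cd: "continuous_on (closure \<Omega>) d"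
    using u d by (auto simp: W1_infty_0_def)
  have M: "0 \<le> M" unfolding M_def by (rule W1_infty_0_lipschitz(1)[OF assms(1,3) ne u])
  have u_le: "\<bar>u x\<bar> \<le> M * d x" if "x \<in> \<Omega>" for x
    unfolding M_def d_def by (rule W1_infty_0_le_J_infdist[OF assms(1,3) u that])
  have Iu: "0 < I u" unfolding I_def
    by (rule integral_abs_powr_pos[OF assms(1,3) cu p x0])
  have Id: "0 < I d" unfolding I_def
    using d_pos[OF x0(1)] by (intro integral_abs_powr_pos[OF assms(1,3) cd p x0(1)]) simp
  \<comment> \<open>Minimality is tested against the competitor \<open>d\<close>, which is
    admissible because it is positive at \<open>x0\<close>.\<close>
  have "\<not> J \<Omega> d / Lp_norm p \<Omega> d < M / Lp_norm p \<Omega> u"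
    using assms(5) d d_pos[OF x0(1)] x0(1) unfolding is_arg_min_def M_def
    by (metis less_irrefl)
  then have "M / I u powr (1 / p) \<le> J \<Omega> d / I d powr (1 / p)"
    by (simp add: Lp_norm_def I_def)
  also have "\<dots> \<le> 1 / I d powr (1 / p)"
    using Jd by (intro divide_right_mono) auto
  finally have "M * I d powr (1 / p) \<le> I u powr (1 / p)"
    using Iu Id by (simp add: field_simps)
  then have "(M * I d powr (1 / p)) powr p \<le> (I u powr (1 / p)) powr p"
    using M p by (intro powr_mono2) auto
  then have ineq: "M powr p * I d \<le> I u"
    using M p Iu Id by (simp add: powr_mult powr_powr)
  have iu: "integrable (lebesgue_on \<Omega>) (\<lambda>x. \<bar>u x\<bar> powr p)"
    and id: "integrable (lebesgue_on \<Omega>) (\<lambda>x. \<bar>d x\<bar> powr p)"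
    using abs_powr_continuous_integrable(2)[OF assms(1,3) _ p] cu cd by blast+
  have eq: "\<bar>u x\<bar> = M * d x" if "x \<in> \<Omega>" for x
  proof -
    \<comment> \<open>This function is nonnegative by \<open>u_le\<close>, and its integral
      \<open>M powr p * I d - I u\<close> is at most 0 by minimality.\<close>
    have "M powr p * \<bar>d x\<bar> powr p - \<bar>u x\<bar> powr p = 0"
    proof (rule continuous_integral_le_0_imp_eq_0[OF assms(1) _ _ _ _ that])
      show "continuous_on \<Omega> (\<lambda>x. M powr p * \<bar>d x\<bar> powr p - \<bar>u x\<bar> powr p)"
        by (intro continuous_on_diff continuous_on_mult continuous_on_const
            abs_powr_continuous_integrable(1)[OF assms(1,3) _ p] cu cd)
      show "integrable (lebesgue_on \<Omega>) (\<lambda>x. M powr p * \<bar>d x\<bar> powr p - \<bar>u x\<bar> powr p)"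
        using iu id by simp
      show "(LINT x|lebesgue_on \<Omega>. M powr p * \<bar>d x\<bar> powr p - \<bar>u x\<bar> powr p) \<le> 0"
        using iu id ineq by (simp add: I_def)
      show "0 \<le> M powr p * \<bar>d y\<bar> powr p - \<bar>u y\<bar> powr p" if "y \<in> \<Omega>" for y
      proof -
        have "\<bar>u y\<bar> powr p \<le> (M * d y) powr p"
          using u_le[OF that] p by (intro powr_mono2) auto
        then show ?thesis using M d_pos[OF that] by (simp add: powr_mult)
      qed
    qed
    then have "(M * d x) powr p = \<bar>u x\<bar> powr p"
      using M d_pos[OF that] by (simp add: powr_mult)
    \<comment> \<open>Both bases are nonnegative, so the power 1/p undoes the power
      \<open>p\<close>.\<close>
    then have "((M * d x) powr p) powr (1 / p) = (\<bar>u x\<bar> powr p) powr (1 / p)" by simp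
    then show ?thesis using p M d_pos[OF that] by (simp add: powr_powr)
  qed
  \<comment> \<open>The quotient is continuous and takes at most the two values \<open>M\<close> and
    \<open>- M\<close>, so it is constant on the connected set.\<close>
  have "(\<lambda>x. u x / d x) constant_on \<Omega>"
  proof (rule continuous_finite_range_constant[OF assms(2)])
    have "continuous_on \<Omega> u" "continuous_on \<Omega> d"
      using cu cd closure_subset continuous_on_subset by blast+
    then show "continuous_on \<Omega> (\<lambda>x. u x / d x)"
      using d_pos by (intro continuous_on_divide) force+
    have "u x / d x \<in> {M, - M}" if "x \<in> \<Omega>" for x
      using eq[OF that] d_pos[OF that] by (auto simp: abs_if field_simps split: if_splits)
    then have "(\<lambda>x. u x / d x) ` \<Omega> \<subseteq> {M, - M}" by blast
    then show "finite ((\<lambda>x. u x / d x) ` \<Omega>)" by (rule finite_subset) simp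
  qed
  then obtain c where c: "\<And>x. x \<in> \<Omega> \<Longrightarrow> u x / d x = c"
    unfolding constant_on_def by blast
  then have "u x = c * d x" if "x \<in> \<Omega>" for x
    using c[OF that] d_pos[OF that] by (simp add: field_simps)
  then show ?thesis unfolding d_def by blast
qed

end
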